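(* Let $N$ be a nontrivial normal subgroup of $B_n$ such that the restriction of the Dehornoy ordering to $N$ is discrete. Then the least positive element of $N$ is either a positive power of $\sigma_1$, or lies in $C(r)$, where $r$ is the largest integer with $3\le r\le n$ such that $N\cap B_{r-1}$ is trivial.
   Context: $B_n$ is the Artin braid group with generators $\sigma_1,\dots,\sigma_{n-1}$; $B_{m}\subset B_n$ for $m\le n$ via $\sigma_i\mapsto\sigma_i$. A word in the generators is $i$-positive if it contains only $\sigma_1,\dots,\sigma_i$ and their inverses, $\sigma_i$ occurs, and every occurrence of $\sigma_i$ has positive exponent; a braid is $i$-positive if some representative word is. The Dehornoy ordering is the left-invariant total order on $B_n$ whose positive cone consists of all braids that are $i$-positive for some $i$. For $r\ge 2$, $C(r)$ denotes the centralizer of $B_{r-1}$ in $B_r$ (viewed inside $B_n$). *)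

theory Defs
  imports "HOL-Algebra.Algebra"
begin

text \<open>Braid words: a letter (i, True) stands for sigma_i, (i, False) for its inverse.\<close>
type_synonym bword = "(nat \<times> bool) list"

definition valid_word :: "nat \<Rightarrow> bword \<Rightarrow> bool" where
  "valid_word n w = (\<forall>p\<in>set w. 1 \<le> fst p \<and> fst p < n)"

inductive beq :: "nat \<Rightarrow> bword \<Rightarrow> bword \<Rightarrow> bool" for n :: nat where
  beq_refl: "valid_word n w \<Longrightarrow> beq n w w"
| beq_sym: "beq n u v \<Longrightarrow> beq n v u"
| beq_trans: "beq n u v \<Longrightarrow> beq n v w \<Longrightarrow> beq n u w"
| beq_cancel: "valid_word n u \<Longrightarrow> valid_word n v \<Longrightarrow> 1 \<le> i \<Longrightarrow> i < n \<Longrightarrow>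
     beq n (u @ [(i, b), (i, \<not> b)] @ v) (u @ v)"
| beq_comm: "valid_word n u \<Longrightarrow> valid_word n v \<Longrightarrow> 1 \<le> i \<Longrightarrow> i + 1 < j \<Longrightarrow> j < n \<Longrightarrow>
     beq n (u @ [(i, True), (j, True)] @ v) (u @ [(j, True), (i, True)] @ v)"
| beq_braid: "valid_word n u \<Longrightarrow> valid_word n v \<Longrightarrow> 1 \<le> i \<Longrightarrow> i + 1 < n \<Longrightarrow>
     beq n (u @ [(i, True), (i + 1, True), (i, True)] @ v)
           (u @ [(i + 1, True), (i, True), (i + 1, True)] @ v)"

definition bclass :: "nat \<Rightarrow> bword \<Rightarrow> bword set" where
  "bclass n w = {v. beq n w v}"

definition braid_group :: "nat \<Rightarrow> bword set monoid" where
  "braid_group n = \<lparr> carrier = {bclass n w | w. valid_word n w},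
     monoid.mult = (\<lambda>A B. bclass n ((SOME a. a \<in> A) @ (SOME b. b \<in> B))),
     monoid.one = bclass n [] \<rparr>"

definition sigma :: "nat \<Rightarrow> nat \<Rightarrow> bword set" where
  "sigma n i = bclass n [(i, True)]"

definition sub_braid :: "nat \<Rightarrow> nat \<Rightarrow> bword set set" where
  "sub_braid n m = {bclass n w | w. valid_word m w \<and> valid_word n w}"

definition ipos_word :: "nat \<Rightarrow> bword \<Rightarrow> bool" where
  "ipos_word i w = ((\<forall>p\<in>set w. 1 \<le> fst p \<and> fst p \<le> i) \<and> (i, True) \<in> set w \<and> (i, False) \<notin> set w)"

definition ipos_braid :: "nat \<Rightarrow> nat \<Rightarrow> bword set \<Rightarrow> bool" where
  "ipos_braid n i x = (\<exists>w. valid_word n w \<and> bclass n w = x \<and> ipos_word i w)"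

definition dehornoy_pos :: "nat \<Rightarrow> bword set set" where
  "dehornoy_pos n = {x \<in> carrier (braid_group n). \<exists>i. ipos_braid n i x}"

definition dless :: "nat \<Rightarrow> bword set \<Rightarrow> bword set \<Rightarrow> bool" where
  "dless n x y = (x \<in> carrier (braid_group n) \<and> y \<in> carrier (braid_group n) \<and>
      inv\<^bsub>braid_group n\<^esub> x \<otimes>\<^bsub>braid_group n\<^esub> y \<in> dehornoy_pos n)"

definition discrete_on :: "nat \<Rightarrow> bword set set \<Rightarrow> bool" where
  "discrete_on n S = (\<forall>g\<in>S.
      (\<exists>h\<in>S. dless n g h \<and> \<not> (\<exists>k\<in>S. dless n g k \<and> dless n k h)) \<and>
      (\<exists>h\<in>S. dless n h g \<and> \<not> (\<exists>k\<in>S. dless n h k \<and> dless n k g)))"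

definition least_positive :: "nat \<Rightarrow> bword set set \<Rightarrow> bword set \<Rightarrow> bool" where
  "least_positive n S m = (m \<in> S \<and> dless n \<one>\<^bsub>braid_group n\<^esub> m \<and>
      (\<forall>x\<in>S. dless n \<one>\<^bsub>braid_group n\<^esub> x \<longrightarrow> m = x \<or> dless n m x))"

definition centr :: "nat \<Rightarrow> nat \<Rightarrow> bword set set" where
  "centr n r = {x \<in> sub_braid n r. \<forall>y\<in>sub_braid n (r - 1).
      x \<otimes>\<^bsub>braid_group n\<^esub> y = y \<otimes>\<^bsub>braid_group n\<^esub> x}"

end

(* The restriction of the ordering to N is discrete, so 1 is not a positive element: otherwise
   every g would satisfy g < g, and no element would have an immediate successor. This yields the
   acyclicity half of Dehornoy's theorem for B_n for free.

   For the comparison half, write a braid as p^-1 q with p, q positive and work in the finite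
   Cayley graph of the divisors of a common multiple of p and q. Call a path m-positive if it uses
   letters up to m and traverses edges labelled m only upwards. By acyclicity, m-positivity is a
   well-founded strict order on this graph. By induction on m, any two vertices connected by letters
   up to m are joined by a path that is k-positive or k-negative for some k <= m: a handle
   sigma_m w sigma_m^-1 whose middle part w is sigma_(m-1)-positive or -negative or
   free of sigma_(m-1) can be resolved inside the graph, by the existence of lcms.

   Now let h be the successor of 1 in N, and let h be i-positive. If i = 1, it is a power of
   sigma_1. Otherwise N and B_i (generated by sigma_1, ..., sigma_(i-1)) meet trivially, because
   y^-1 h is i-positive for every y in B_i, so r = i + 1. For y in B_i the commutators
   h^-1 y h y^-1 and h^-1 y^-1 h y are both >= 1 by minimality of h. The first is trivial or
   i-positive, so its conjugate by y^-1, which is the inverse of the second, is also >= 1;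
   hence both are trivial. *)

theory Submission
  imports Defs
begin

section \<open>Handle removal in a finite Cayley graph\<close>

definition far :: "nat \<Rightarrow> nat \<Rightarrow> bool" where
  "far i j \<longleftrightarrow> i + 1 < j \<or> j + 1 < i"

definition adj :: "nat \<Rightarrow> nat \<Rightarrow> bool" where
  "adj i j \<longleftrightarrow> j = i + 1 \<or> i = j + 1"

lemma far_sym: "far i j \<Longrightarrow> far j i"
  and adj_sym: "adj i j \<Longrightarrow> adj j i"
  by (auto simp: far_def adj_def)

lemma eq_far_adj_cases:
  obtains "i = j" | "far i j" "i \<noteq> j" | "adj i j" "i \<noteq> j"
  unfolding far_def adj_def by linarith

text \<open>The empty path says nothing about its vertex, so one endpoint has to be given in
  \<open>S\<close>. This confines paths that contain an edge to a finite set of vertices.\<close>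

lemma rtranclp_edge_ends:
  assumes "R\<^sup>*\<^sup>* x y" "\<And>u v. R u v \<Longrightarrow> u \<in> S \<and> v \<in> S" "x \<in> S \<or> y \<in> S"
  shows "x \<in> S \<and> y \<in> S"
  using assms(1,3) by (induction rule: rtranclp_induct) (use assms(2) in blast)+

text \<open>\<open>E i a b\<close> stands for \<open>b = a \<sigma>\<^sub>i\<close>. The assumptions hold for the divisors of an element in a
  Garside monoid; in the whole Cayley graph of the braid group only the last two fail.\<close>
locale braid_graph =
  fixes E :: "nat \<Rightarrow> 'v \<Rightarrow> 'v \<Rightarrow> bool"
  assumes source_unique: "E i a c \<Longrightarrow> E i b c \<Longrightarrow> a = b"
    and target_unique: "E i a b \<Longrightarrow> E i a c \<Longrightarrow> b = c"
    and far_square: "far i j \<Longrightarrow> E i a b \<Longrightarrow> E j b c \<Longrightarrow> \<exists>d. E j a d \<and> E i d c"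
    and far_lower: "far i j \<Longrightarrow> E i a c \<Longrightarrow> E j b c \<Longrightarrow> \<exists>d. E j d a \<and> E i d b"
    and far_upper: "far i j \<Longrightarrow> E i a b \<Longrightarrow> E j a c \<Longrightarrow> \<exists>d. E j b d \<and> E i c d"
    and adj_lower: "adj i j \<Longrightarrow> E i a c \<Longrightarrow> E j b c \<Longrightarrow>
      \<exists>d p q. E i d p \<and> E j p a \<and> E j d q \<and> E i q b"
    and adj_upper: "adj i j \<Longrightarrow> E i a b \<Longrightarrow> E j a c \<Longrightarrow>
      \<exists>d p q. E j b p \<and> E i p d \<and> E i c q \<and> E j q d"
    and wf_down: "wfp (\<lambda>b a. \<exists>i. E i a b)"
    and finite_edges: "finite {(a, b). \<exists>i. E i a b}"
begin

text \<open>A connected component of \<open>link m\<close> plays the role of a left coset of B_m;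
  the bound is strict because B_m is generated by the letters below \<open>m\<close>.\<close>

definition link :: "nat \<Rightarrow> 'v \<Rightarrow> 'v \<Rightarrow> bool" where
  "link m a b \<longleftrightarrow> (\<exists>i<m. E i a b \<or> E i b a)"

definition nonneg :: "nat \<Rightarrow> 'v \<Rightarrow> 'v \<Rightarrow> bool" where
  "nonneg m = (sup (link m) (E m))\<^sup>*\<^sup>*"

text \<open>\<open>pos m a b\<close>: some path from \<open>a\<close> to \<open>b\<close> spells an \<open>m\<close>-positive word.\<close>
definition pos :: "nat \<Rightarrow> 'v \<Rightarrow> 'v \<Rightarrow> bool" where
  "pos m a b \<longleftrightarrow> (\<exists>x y. nonneg m a x \<and> E m x y \<and> nonneg m y b)"

lemma link_sym: "link m a b \<Longrightarrow> link m b a"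
  by (auto simp: link_def)

lemma linkI: "i < m \<Longrightarrow> E i a b \<Longrightarrow> link m a b" "i < m \<Longrightarrow> E i b a \<Longrightarrow> link m a b"
  by (auto simp: link_def)

lemma conn_sym: "(link m)\<^sup>*\<^sup>* a b \<Longrightarrow> (link m)\<^sup>*\<^sup>* b a"
  by (induction rule: rtranclp_induct) (auto intro: converse_rtranclp_into_rtranclp link_sym)

lemma conn_nonneg: "(link m)\<^sup>*\<^sup>* a b \<Longrightarrow> nonneg m a b"
  unfolding nonneg_def by (rule rtranclp_mono[THEN predicate2D, rotated]) auto

lemma nonneg_refl: "nonneg m a a"
  by (simp add: nonneg_def)

lemma nonneg_trans: "nonneg m a b \<Longrightarrow> nonneg m b c \<Longrightarrow> nonneg m a c"
  unfolding nonneg_def by (rule rtranclp_trans)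

lemma E_nonneg: "E m a b \<Longrightarrow> nonneg m a b"
  unfolding nonneg_def by (intro r_into_rtranclp) simp

lemma link_nonneg: "link m a b \<Longrightarrow> nonneg m a b"
  unfolding nonneg_def by (intro r_into_rtranclp) simp

lemma pos_trans: "pos m a b \<Longrightarrow> pos m b c \<Longrightarrow> pos m a c"
  unfolding pos_def by (meson E_nonneg nonneg_trans)

lemma pos_nonneg: "pos m a b \<Longrightarrow> nonneg m a b"
  unfolding pos_def by (meson E_nonneg nonneg_trans)

text \<open>The path is cut after its last edge labelled \<open>m\<close>; what follows uses only
  letters below \<open>m\<close>.\<close>

lemma nonneg_cases:
  assumes "nonneg m a b"
  obtains "(link m)\<^sup>*\<^sup>* a b"
    | x y where "nonneg m a x" "E m x y" "(link m)\<^sup>*\<^sup>* y b"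
proof -
  from assms have "(link m)\<^sup>*\<^sup>* a b \<or> (\<exists>x y. nonneg m a x \<and> E m x y \<and> (link m)\<^sup>*\<^sup>* y b)"
    unfolding nonneg_def
  proof (induction rule: rtranclp_induct)
    case (step b c)
    from step.hyps(2) consider "link m b c" | "E m b c" by auto
    then show ?case
    proof cases
      case 1
      with step.IH show ?thesis by (meson rtranclp.rtrancl_into_rtrancl)
    next
      case 2
      with step.hyps(1) show ?thesis by blast
    qed
  qed simp
  then show thesis using that by blast
qed

lemma nonneg_mono: "k < m \<Longrightarrow> nonneg k a b \<Longrightarrow> (link m)\<^sup>*\<^sup>* a b"
  unfolding nonneg_def by (erule rtranclp_mono[THEN predicate2D, rotated])
    (use order.strict_trans in \<open>unfold link_def, blast\<close>)

text \<open>The handle \<open>\<sigma>\<^sub>m w \<sigma>\<^sub>m\<^sup>-\<^sup>1\<close>, where the letters of \<open>w\<close> are below \<open>m\<close> and \<open>\<sigma>\<close>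
  of index \<open>m - 1\<close> occurs in it only positively, is removed by
  \<open>\<sigma>\<^sub>m \<sigma>\<^sub>k \<sigma>\<^sub>m\<^sup>-\<^sup>1 = \<sigma>\<^sub>k\<^sup>-\<^sup>1 \<sigma>\<^sub>m \<sigma>\<^sub>k\<close> for \<open>k = m - 1\<close>.\<close>
lemma nonneg_below_common_edge:
  assumes "nonneg k b' c'" "E (Suc k) b b'" "E (Suc k) c c'"
  shows "nonneg (Suc k) b c"
proof -
  \<comment> \<open>The induction runs backwards from \<open>c'\<close>: every vertex of the path
    receives an edge labelled \<open>Suc k\<close>, and \<open>source_unique\<close> finally
    identifies the source over \<open>b'\<close> with \<open>b\<close>.\<close>
  have "\<exists>d. E (Suc k) d b' \<and> nonneg (Suc k) d c"
    using assms(1) unfolding nonneg_def[of k]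
  proof (induction rule: converse_rtranclp_induct)
    case base
    then show ?case using assms(3) nonneg_refl by blast
  next
    case (step x y)
    then obtain d where d: "E (Suc k) d y" "nonneg (Suc k) d c" by blast
    from step.hyps(1) consider i where "i < k" "E i x y" | i where "i < k" "E i y x" | "E k x y"
      by (auto simp: link_def)
    then show ?case
    proof cases
      case 1
      then have "far i (Suc k)" by (simp add: far_def)
      from far_lower[OF this 1(2) d(1)] obtain z where "E (Suc k) z x" "E i z d" by blast
      moreover from this 1 have "nonneg (Suc k) z d" by (intro link_nonneg linkI(1)[of i]) auto
      ultimately show ?thesis using d nonneg_trans by blast
    next
      case 2
      then have "far (Suc k) i" by (simp add: far_def)
      from far_square[OF this d(1) 2(2)] obtain z where "E i d z" "E (Suc k) z x" by blast
      moreover from this 2 have "nonneg (Suc k) z d" by (intro link_nonneg linkI(2)[of i]) auto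
      ultimately show ?thesis using d nonneg_trans by blast
    next
      case 3
      have "adj k (Suc k)" by (simp add: adj_def)
      from adj_lower[OF this 3 d(1)] obtain z p q where
        z: "E k z p" "E (Suc k) p x" "E (Suc k) z q" "E k q d" by blast
      have "nonneg (Suc k) p z" using z(1) by (intro link_nonneg linkI(2)[of k]) auto
      moreover have "nonneg (Suc k) z q" using z(3) by (rule E_nonneg)
      moreover have "nonneg (Suc k) q d" using z(4) by (intro link_nonneg linkI(1)[of k]) auto
      ultimately have "nonneg (Suc k) p c" using d(2) by (meson nonneg_trans)
      with z(2) show ?thesis by blast
    qed
  qed
  then show ?thesis using source_unique assms(2) by blast
qed

section \<open>Upper bounds of connected vertices by confluence\<close>

lemma local_confluence:
  assumes "i \<le> m" "j \<le> m" "E i a b" "E j a c"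
  shows "\<exists>d. (\<lambda>a b. \<exists>i\<le>m. E i a b)\<^sup>*\<^sup>* b d \<and> (\<lambda>a b. \<exists>i\<le>m. E i a b)\<^sup>*\<^sup>* c d"
    (is "\<exists>d. ?U\<^sup>*\<^sup>* b d \<and> _ c d")
proof (cases i j rule: eq_far_adj_cases)
  case 1
  then show ?thesis using target_unique assms by blast
next
  case 2
  then obtain d where "E j b d" "E i c d" using far_upper assms by blast
  then have "?U b d" "?U c d" using assms by auto
  then show ?thesis by blast
next
  case 3
  then obtain d p q where "E j b p" "E i p d" "E i c q" "E j q d" using adj_upper assms by metis
  then have "?U b p" "?U p d" "?U c q" "?U q d" using assms by auto
  then have "?U\<^sup>*\<^sup>* b d" "?U\<^sup>*\<^sup>* c d" by (simp_all add: converse_rtranclp_into_rtranclp)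
  then show ?thesis by blast
qed

text \<open>Newman's lemma: ascending paths terminate by \<open>wf_down\<close>, and the squares and
  hexagons of \<open>local_confluence\<close> bring in no new labels, so the bound \<open>m\<close>
  persists.\<close>

lemma confluence:
  fixes m defines "U \<equiv> \<lambda>a b. \<exists>i\<le>m. E i a b"
  assumes "U\<^sup>*\<^sup>* a b" "U\<^sup>*\<^sup>* a c"
  shows "\<exists>d. U\<^sup>*\<^sup>* b d \<and> U\<^sup>*\<^sup>* c d"
  using wf_down assms(2,3)
proof (induction a arbitrary: b c rule: wfp_induct_rule)
  case (less a)
  show ?case
  proof (cases "a = b \<or> a = c")
    case True
    then show ?thesis using less.prems by blast
  next
    case False
    then obtain b1 c1 where 1: "U a b1" "U\<^sup>*\<^sup>* b1 b" "U a c1" "U\<^sup>*\<^sup>* c1 c"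
      using less.prems by (metis converse_rtranclpE)
    then obtain d where d: "U\<^sup>*\<^sup>* b1 d" "U\<^sup>*\<^sup>* c1 d"
      using local_confluence unfolding U_def by blast
    from 1 have e: "\<exists>i. E i a b1" "\<exists>i. E i a c1" by (auto simp: U_def)
    obtain x where x: "U\<^sup>*\<^sup>* b x" "U\<^sup>*\<^sup>* d x" using less.IH[OF e(1) 1(2) d(1)] by blast
    have "U\<^sup>*\<^sup>* c1 x" using d(2) x(2) by (rule rtranclp_trans)
    from less.IH[OF e(2) 1(4) this] obtain y where "U\<^sup>*\<^sup>* c y" "U\<^sup>*\<^sup>* x y" by blast
    with x(1) show ?thesis by (meson rtranclp_trans)
  qed
qed

text \<open>The upper bound is updated along a connecting path: a descending edge only prolongs the
  path to \<open>v\<close>, an ascending one is merged with it by \<open>confluence\<close>.\<close>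

lemma upper_bound:
  assumes "(link (Suc m))\<^sup>*\<^sup>* a b"
  shows "\<exists>v. nonneg m a v \<and> nonneg m b v"
proof -
  define U where "U = (\<lambda>a b. \<exists>i\<le>m. E i a b)"
  have "\<exists>v. U\<^sup>*\<^sup>* a v \<and> U\<^sup>*\<^sup>* b v"
    using assms
  proof (induction rule: rtranclp_induct)
    case (step b c)
    then obtain v where v: "U\<^sup>*\<^sup>* a v" "U\<^sup>*\<^sup>* b v" by blast
    from step.hyps(2) consider "U b c" | "U c b" by (auto simp: link_def U_def less_Suc_eq_le)
    then show ?case
    proof cases
      case 1
      then have "U\<^sup>*\<^sup>* b c" by blast
      then obtain d where "U\<^sup>*\<^sup>* v d" "U\<^sup>*\<^sup>* c d"
        using confluence v(2) unfolding U_def by blast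
      with v show ?thesis by (meson rtranclp_trans)
    next
      case 2
      with v show ?thesis by (meson converse_rtranclp_into_rtranclp)
    qed
  qed blast
  moreover have "U \<le> sup (link m) (E m)"
  proof (intro predicate2I)
    fix x y assume "U x y"
    then obtain i where "i \<le> m" "E i x y" by (auto simp: U_def)
    then show "sup (link m) (E m) x y" using linkI(1)[of i m x y] by (cases "i = m") auto
  qed
  then have "U\<^sup>*\<^sup>* x y \<Longrightarrow> nonneg m x y" for x y
    unfolding nonneg_def using rtranclp_mono by blast
  ultimately show ?thesis by blast
qed

text \<open>Transitivity and the assumption make \<open>pos m\<close> acyclic. A \<open>pos\<close>
  path contains an edge, so its ends lie among the finitely many endpoints of edges, and a finite
  acyclic relation is well-founded.\<close>

lemma wf_pos:
  assumes "\<And>a. \<not> pos m a a"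
  shows "wfp (pos m)"
proof -
  define S where "S = fst ` {(a, b). \<exists>i. E i a b} \<union> snd ` {(a, b). \<exists>i. E i a b}"
  have ES: "E i a b \<Longrightarrow> a \<in> S \<and> b \<in> S" for i a b
    unfolding S_def by force
  have "sup (link m) (E m) u v \<Longrightarrow> u \<in> S \<and> v \<in> S" for u v
    using ES by (auto simp: link_def)
  note nonneg_S = rtranclp_edge_ends[of "sup (link m) (E m)" _ _ S, OF _ this, folded nonneg_def]
  have "a \<in> S \<and> b \<in> S" if "pos m a b" for a b
    using that nonneg_S ES unfolding pos_def by meson
  then have "{(a, b). pos m a b} \<subseteq> S \<times> S" by auto
  moreover have "finite S" using finite_edges by (simp add: S_def)
  ultimately have "finite {(a, b). pos m a b}" by (meson finite_SigmaI finite_subset)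
  moreover have "acyclic {(a, b). pos m a b}"
  proof -
    have "trans {(a, b). pos m a b}" using pos_trans by (auto intro!: transI)
    then show ?thesis using assms by (simp add: acyclic_def)
  qed
  ultimately show ?thesis by (simp add: wfp_def finite_acyclic_wf)
qed

text \<open>Two elements below \<open>v\<close> lie below sources \<open>b\<close>, \<open>c\<close> of edges ending in the class of \<open>v\<close>. These
  sources are comparable by removal of a handle, and the larger one is strictly below \<open>v\<close>, so
  well-founded induction applies.\<close>
theorem comparable:
  assumes "\<And>m a. \<not> pos m a a" "(link m)\<^sup>*\<^sup>* a b"
  shows "a = b \<or> (\<exists>k<m. pos k a b \<or> pos k b a)"
  using assms(2)
proof (induction m arbitrary: a b)
  case 0
  then show ?case by (induction rule: rtranclp_induct) (auto simp: link_def)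
next
  case (Suc m)
  have edges: "nonneg m b c \<or> nonneg m c b"
    if "E m b b'" "E m c c'" "(link m)\<^sup>*\<^sup>* b' c'" for b b' c c'
  proof (cases m)
    case 0
    with Suc.IH[OF that(3)] have "b' = c'" by simp
    with that source_unique nonneg_refl show ?thesis by blast
  next
    case (Suc l)
    \<comment> \<open>A comparison at an index \<open>k < l\<close> uses only letters below
      \<open>l\<close>, so it is vacuously nonnegative at \<open>l\<close>, the index that handle
      removal requires.\<close>
    have *: "nonneg l x y" if "pos k x y" "k < m" for k x y
    proof (cases "k = l")
      case True
      with that pos_nonneg show ?thesis by blast
    next
      case False
      with that Suc have "k < l" by simp
      with that pos_nonneg nonneg_mono conn_nonneg show ?thesis by blast
    qed
    from Suc.IH[OF that(3)] have "nonneg l b' c' \<or> nonneg l c' b'" using * nonneg_refl by blast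
    with that nonneg_below_common_edge Suc show ?thesis by blast
  qed
  have total: "nonneg m x y \<or> nonneg m y x" if "nonneg m x v" "nonneg m y v" for v x y
    using wf_pos[of m, OF assms(1)] that
  proof (induction v arbitrary: x y rule: wfp_induct_rule)
    case (less v)
    show ?case
    proof (rule nonneg_cases[OF less.prems(1)])
      assume "(link m)\<^sup>*\<^sup>* x v"
      then show ?thesis using less.prems conn_sym conn_nonneg nonneg_trans by blast
    next
      fix b b' assume b: "nonneg m x b" "E m b b'" "(link m)\<^sup>*\<^sup>* b' v"
      show ?thesis
      proof (rule nonneg_cases[OF less.prems(2)])
        assume "(link m)\<^sup>*\<^sup>* y v"
        then show ?thesis using less.prems conn_sym conn_nonneg nonneg_trans by blast
      next
        fix c c' assume c: "nonneg m y c" "E m c c'" "(link m)\<^sup>*\<^sup>* c' v"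
        have "(link m)\<^sup>*\<^sup>* b' c'" using b c conn_sym by (meson rtranclp_trans)
        then have "nonneg m b c \<or> nonneg m c b" using edges b c by blast
        moreover have "pos m b v" "pos m c v" using b c conn_nonneg nonneg_refl unfolding pos_def by blast+
        ultimately show ?thesis using less.IH b(1) c(1) nonneg_trans by meson
      qed
    qed
  qed
  have *: "(link m)\<^sup>*\<^sup>* x y \<or> pos m x y" if "nonneg m x y" for x y
    using that by (cases rule: nonneg_cases) (auto simp: pos_def dest: conn_nonneg)
  obtain v where "nonneg m a v" "nonneg m b v" using upper_bound Suc.prems by blast
  then have "nonneg m a b \<or> nonneg m b a" using total by blast
  then have "(link m)\<^sup>*\<^sup>* a b \<or> pos m a b \<or> pos m b a" using * conn_sym by blast
  then show ?case using Suc.IH less_Suc_eq by blast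
qed

end

section \<open>The positive braid monoid\<close>

text \<open>The number of strands is left open: the relations preserve the set of letters, so a
  bound can be imposed on the letters when it is needed.\<close>

inductive pstep :: "nat list \<Rightarrow> nat list \<Rightarrow> bool" where
  pstep_far: "far i j \<Longrightarrow> pstep (u @ [i, j] @ v) (u @ [j, i] @ v)"
| pstep_adj: "adj i j \<Longrightarrow> pstep (u @ [i, j, i] @ v) (u @ [j, i, j] @ v)"

abbreviation peq :: "nat list \<Rightarrow> nat list \<Rightarrow> bool" (infix "\<bowtie>" 50) where
  "u \<bowtie> v \<equiv> pstep\<^sup>*\<^sup>* u v"

lemma pstep_sym: "pstep u v \<Longrightarrow> pstep v u"
  by (induction rule: pstep.induct) (use pstep.intros far_sym adj_sym in blast)+

lemma peq_sym: "u \<bowtie> v \<Longrightarrow> v \<bowtie> u"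
  by (induction rule: rtranclp_induct) (auto intro: converse_rtranclp_into_rtranclp pstep_sym)

lemmas peq_trans [trans] = rtranclp_trans[of pstep]

lemma pstep_context: "pstep u v \<Longrightarrow> pstep (x @ u @ y) (x @ v @ y)"
proof (induction rule: pstep.induct)
  case (pstep_far i j u v)
  then show ?case using pstep.pstep_far[of i j "x @ u" "v @ y"] by simp
next
  case (pstep_adj i j u v)
  then show ?case using pstep.pstep_adj[of i j "x @ u" "v @ y"] by simp
qed

lemma peq_context: "u \<bowtie> v \<Longrightarrow> x @ u @ y \<bowtie> x @ v @ y"
  by (induction rule: rtranclp_induct) (auto intro: rtranclp.rtrancl_into_rtrancl pstep_context)

lemma peq_append: "u \<bowtie> u' \<Longrightarrow> v \<bowtie> v' \<Longrightarrow> u @ v \<bowtie> u' @ v'"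
  using peq_context[of u u' "[]" v] peq_context[of v v' u' "[]"] by (metis append_Nil append_Nil2 peq_trans)

lemma peq_Cons: "u \<bowtie> v \<Longrightarrow> i # u \<bowtie> i # v"
  using peq_context[of u v "[i]" "[]"] by simp

lemma peq_far: "far i j \<Longrightarrow> i # j # u \<bowtie> j # i # u"
  using pstep_far[of i j "[]" u] by auto

lemma peq_adj: "adj i j \<Longrightarrow> i # j # i # u \<bowtie> j # i # j # u"
  using pstep_adj[of i j "[]" u] by auto

lemma peq_length: "u \<bowtie> v \<Longrightarrow> length u = length v"
  by (induction rule: rtranclp_induct) (auto elim: pstep.cases)

lemma peq_set: "u \<bowtie> v \<Longrightarrow> set u = set v"
proof (induction rule: rtranclp_induct)
  case (step v w)
  from step.hyps(2) have "set v = set w" by (cases rule: pstep.cases) auto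
  with step show ?case by simp
qed simp

lemma pstep_rev: "pstep u v \<Longrightarrow> pstep (rev u) (rev v)"
proof (induction rule: pstep.induct)
  case (pstep_far i j u v)
  then show ?case using pstep.pstep_far[of j i "rev v" "rev u"] far_sym by simp
next
  case (pstep_adj i j u v)
  then show ?case using pstep.pstep_adj[of i j "rev v" "rev u"] by simp
qed

lemma peq_rev: "u \<bowtie> v \<Longrightarrow> rev u \<bowtie> rev v"
  by (induction rule: rtranclp_induct) (auto intro: rtranclp.rtrancl_into_rtrancl pstep_rev)

section \<open>Garside's lemma and cancellation\<close>

text \<open>The shape that \<open>\<sigma>\<^sub>i x = \<sigma>\<^sub>j y\<close> forces on \<open>x\<close> and \<open>y\<close>: both sides are a multiple of the lcm of
  \<open>\<sigma>\<^sub>i\<close> and \<open>\<sigma>\<^sub>j\<close>.\<close>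
definition lcm_rel :: "nat \<Rightarrow> nat \<Rightarrow> nat list \<Rightarrow> nat list \<Rightarrow> bool" where
  "lcm_rel i j x y \<longleftrightarrow> (i = j \<longrightarrow> x \<bowtie> y) \<and>
     (far i j \<longrightarrow> (\<exists>Z. x \<bowtie> j # Z \<and> y \<bowtie> i # Z)) \<and>
     (adj i j \<longrightarrow> (\<exists>Z. x \<bowtie> j # i # Z \<and> y \<bowtie> i # j # Z))"

lemma lcm_rel_sym: "lcm_rel i j x y \<Longrightarrow> lcm_rel j i y x"
  unfolding lcm_rel_def using far_sym adj_sym peq_sym by meson

lemma lcm_rel_eqI: "x \<bowtie> y \<Longrightarrow> lcm_rel i i x y"
  by (auto simp: lcm_rel_def far_def adj_def)

lemma lcm_rel_farI: "far i j \<Longrightarrow> x \<bowtie> j # Z \<Longrightarrow> y \<bowtie> i # Z \<Longrightarrow> lcm_rel i j x y"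
  by (auto simp: lcm_rel_def far_def adj_def)

lemma lcm_rel_adjI: "adj i j \<Longrightarrow> x \<bowtie> j # i # Z \<Longrightarrow> y \<bowtie> i # j # Z \<Longrightarrow> lcm_rel i j x y"
  by (auto simp: lcm_rel_def far_def adj_def)

lemma lcm_rel_peq: "lcm_rel i j x y \<Longrightarrow> x' \<bowtie> x \<Longrightarrow> y' \<bowtie> y \<Longrightarrow> lcm_rel i j x' y'"
  unfolding lcm_rel_def by (meson peq_sym peq_trans)

text \<open>A relation applied at the front exhibits the lcm form, with the untouched suffix
  \<open>v\<close> as cofactor; applied further right it keeps the first letter, so
  \<open>i = j\<close>.\<close>

lemma pstep_lcm_rel:
  assumes "pstep (i # x) (j # y)"
  shows "lcm_rel i j x y"
  using assms
proof (cases rule: pstep.cases)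
  case (pstep_far k l u v)
  show ?thesis
  proof (cases u)
    case Nil
    with pstep_far show ?thesis by (auto intro: lcm_rel_farI)
  next
    case (Cons a u')
    with pstep_far pstep.pstep_far[of k l u' v] show ?thesis by (auto intro!: lcm_rel_eqI)
  qed
next
  case (pstep_adj k l u v)
  show ?thesis
  proof (cases u)
    case Nil
    with pstep_adj show ?thesis by (auto intro: lcm_rel_adjI)
  next
    case (Cons a u')
    with pstep_adj pstep.pstep_adj[of k l u' v] show ?thesis by (auto intro!: lcm_rel_eqI)
  qed
qed

text \<open>Mixed case of the transitivity of \<open>lcm_rel\<close>. Garside's lemma for shorter
  words, given as \<open>IH\<close>, peels off letters until the lcm of the three generators
  appears: of type A_1 x A_2 if \<open>far i j\<close>, of type A_3 if
  \<open>adj i j\<close>.\<close>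

lemma lcm_rel_far_adj_trans:
  assumes IH: "\<And>i j x' y'. length x' < length x \<Longrightarrow> i # x' \<bowtie> j # y' \<Longrightarrow> lcm_rel i j x' y'"
    and ik: "far i k" "x \<bowtie> k # Z" "W \<bowtie> i # Z"
    and kj: "adj k j" "W \<bowtie> j # k # Z'" "y \<bowtie> k # j # Z'"
  shows "lcm_rel i j x y"
proof -
  have ZZ': "i # Z \<bowtie> j # k # Z'" using ik kj by (meson peq_sym peq_trans)
  have lZ: "length x = Suc (length Z)" "length Z = Suc (length Z')"
    using peq_length[OF ik(2)] peq_length[OF ZZ'] by simp_all
  have ijZ: "lcm_rel i j Z (k # Z')" using IH ZZ' lZ by simp
  from ik(1) kj(1) have "i \<noteq> j" by (auto simp: far_def adj_def)
  then consider "far i j" | "adj i j" using eq_far_adj_cases[of i j] by blast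
  then show ?thesis
  proof cases
    case 1
    then obtain T where T: "Z \<bowtie> j # T" "k # Z' \<bowtie> i # T" using ijZ by (auto simp: lcm_rel_def)
    have "lcm_rel k i Z' T" using IH T(2) lZ by simp
    then obtain S where S: "Z' \<bowtie> i # S" "T \<bowtie> k # S" using far_sym[OF ik(1)] by (auto simp: lcm_rel_def)
    have "x \<bowtie> k # Z" by fact
    also have "\<dots> \<bowtie> k # j # T" using T by (intro peq_Cons)
    also have "\<dots> \<bowtie> k # j # k # S" using S by (intro peq_Cons)
    also have "\<dots> \<bowtie> j # k # j # S" using kj(1) by (intro peq_adj)
    finally have x: "x \<bowtie> j # k # j # S" .
    have "y \<bowtie> k # j # Z'" by fact
    also have "\<dots> \<bowtie> k # j # i # S" using S by (intro peq_Cons)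
    also have "\<dots> \<bowtie> k # i # j # S" using 1 far_sym by (intro peq_Cons peq_far) auto
    also have "\<dots> \<bowtie> i # k # j # S" using ik far_sym by (intro peq_far) auto
    finally show ?thesis using 1 x by (intro lcm_rel_farI)
  next
    case 2
    then obtain T where T: "Z \<bowtie> j # i # T" "k # Z' \<bowtie> i # j # T" using ijZ by (auto simp: lcm_rel_def)
    have "lcm_rel k i Z' (j # T)" using IH T(2) lZ by simp
    then obtain S where S: "Z' \<bowtie> i # S" "j # T \<bowtie> k # S" using far_sym[OF ik(1)] by (auto simp: lcm_rel_def)
    have "length T < length x" using peq_length[OF T(1)] lZ by simp
    then have "lcm_rel j k T S" using IH S(2) by simp
    then obtain U where U: "T \<bowtie> k # j # U" "S \<bowtie> j # k # U" using adj_sym[OF kj(1)] by (auto simp: lcm_rel_def)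
    have "x \<bowtie> k # Z" by fact
    also have "\<dots> \<bowtie> k # j # i # T" using T by (intro peq_Cons)
    also have "\<dots> \<bowtie> k # j # i # k # j # U" using U by (intro peq_Cons)
    also have "\<dots> \<bowtie> k # j # k # i # j # U" using ik by (intro peq_Cons peq_far)
    also have "\<dots> \<bowtie> j # k # j # i # j # U" using kj by (intro peq_adj)
    also have "\<dots> \<bowtie> j # k # i # j # i # U" using 2 adj_sym by (intro peq_Cons peq_adj) auto
    also have "\<dots> \<bowtie> j # i # k # j # i # U" using ik far_sym by (intro peq_Cons peq_far) auto
    finally have x: "x \<bowtie> j # i # k # j # i # U" .
    have "y \<bowtie> k # j # Z'" by fact
    also have "\<dots> \<bowtie> k # j # i # S" using S by (intro peq_Cons)
    also have "\<dots> \<bowtie> k # j # i # j # k # U" using U by (intro peq_Cons)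
    also have "\<dots> \<bowtie> k # i # j # i # k # U" using 2 adj_sym by (intro peq_Cons peq_adj) auto
    also have "\<dots> \<bowtie> i # k # j # i # k # U" using ik far_sym by (intro peq_far) auto
    also have "\<dots> \<bowtie> i # k # j # k # i # U" using ik by (intro peq_Cons peq_far)
    also have "\<dots> \<bowtie> i # j # k # j # i # U" using kj by (intro peq_Cons peq_adj)
    finally show ?thesis using 2 x by (intro lcm_rel_adjI)
  qed
qed

text \<open>Here \<open>k # W\<close> is an intermediate word of a derivation. The two forms of
  \<open>W\<close> are compared by \<open>IH\<close>, the lemma for shorter words, and the result is
  rearranged into a multiple of the lcm of the generators \<open>i\<close> and
  \<open>j\<close>.\<close>

lemma lcm_rel_trans:
  assumes IH: "\<And>i j x' y'. length x' < length x \<Longrightarrow> i # x' \<bowtie> j # y' \<Longrightarrow> lcm_rel i j x' y'"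
    and ik: "lcm_rel i k x W" and kj: "lcm_rel k j W y"
    and len: "length x = length y"
  shows "lcm_rel i j x y"
proof (cases "i = k \<or> k = j")
  case True
  then show ?thesis
  proof
    assume "i = k"
    then have "x \<bowtie> W" using ik by (simp add: lcm_rel_def)
    then show ?thesis using lcm_rel_peq[OF kj] \<open>i = k\<close> by blast
  next
    assume "k = j"
    then have "y \<bowtie> W" using kj by (simp add: lcm_rel_def peq_sym)
    then show ?thesis using lcm_rel_peq[OF ik] \<open>k = j\<close> by blast
  qed
next
  case False
  then consider "far i k" "far k j" | "far i k" "adj k j" | "adj i k" "far k j" | "adj i k" "adj k j"
    by (metis eq_far_adj_cases)
  then show ?thesis
  proof cases
    case 1
    then obtain Z Z' where Z: "x \<bowtie> k # Z" "W \<bowtie> i # Z" "W \<bowtie> j # Z'" "y \<bowtie> k # Z'"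
      using ik kj by (auto simp: lcm_rel_def)
    have "i # Z \<bowtie> j # Z'" using Z by (meson peq_sym peq_trans)
    then have L: "lcm_rel i j Z Z'" using IH peq_length[OF Z(1)] by simp
    show ?thesis
    proof (cases i j rule: eq_far_adj_cases)
      case eq: 1
      with L have "Z \<bowtie> Z'" by (simp add: lcm_rel_def)
      then have "x \<bowtie> y" using Z by (meson peq_Cons peq_sym peq_trans)
      then show ?thesis using eq by (simp add: lcm_rel_eqI)
    next
      case 2
      then obtain T where T: "Z \<bowtie> j # T" "Z' \<bowtie> i # T" using L by (auto simp: lcm_rel_def)
      have "x \<bowtie> k # j # T" using Z T by (meson peq_Cons peq_trans)
      also have "\<dots> \<bowtie> j # k # T" using 1 by (intro peq_far)
      finally have x: "x \<bowtie> j # k # T" .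
      have "y \<bowtie> k # i # T" using Z T by (meson peq_Cons peq_trans)
      also have "\<dots> \<bowtie> i # k # T" using 1 far_sym by (intro peq_far) auto
      finally show ?thesis using x 2 by (intro lcm_rel_farI)
    next
      case 3
      then obtain T where T: "Z \<bowtie> j # i # T" "Z' \<bowtie> i # j # T" using L by (auto simp: lcm_rel_def)
      have "x \<bowtie> k # j # i # T" using Z T by (meson peq_Cons peq_trans)
      also have "\<dots> \<bowtie> j # k # i # T" using 1 by (intro peq_far)
      also have "\<dots> \<bowtie> j # i # k # T" using 1 far_sym by (intro peq_Cons peq_far) auto
      finally have x: "x \<bowtie> j # i # k # T" .
      have "y \<bowtie> k # i # j # T" using Z T by (meson peq_Cons peq_trans)
      also have "\<dots> \<bowtie> i # k # j # T" using 1 far_sym by (intro peq_far) auto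
      also have "\<dots> \<bowtie> i # j # k # T" using 1 by (intro peq_Cons peq_far)
      finally show ?thesis using x 3 by (intro lcm_rel_adjI)
    qed
  next
    case 2
    then obtain Z Z' where "x \<bowtie> k # Z" "W \<bowtie> i # Z" "W \<bowtie> j # k # Z'" "y \<bowtie> k # j # Z'"
      using ik kj by (auto simp: lcm_rel_def)
    then show ?thesis using lcm_rel_far_adj_trans[OF IH] 2 by blast
  next
    case 3
    then obtain Z Z' where "x \<bowtie> k # i # Z" "W \<bowtie> i # k # Z" "W \<bowtie> j # Z'" "y \<bowtie> k # Z'"
      using ik kj by (auto simp: lcm_rel_def)
    \<comment> \<open>The chain read from \<open>y\<close> to \<open>x\<close> is the preceding
      case; \<open>len\<close> carries the length bound in \<open>IH\<close> over to
      \<open>y\<close>.\<close>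
    moreover have "far j k" "adj k i" using 3 far_sym adj_sym by auto
    ultimately have "lcm_rel j i y x"
      using lcm_rel_far_adj_trans[OF IH[unfolded len]] by blast
    then show ?thesis by (rule lcm_rel_sym)
  next
    case 4
    then obtain Z Z' where Z: "x \<bowtie> k # i # Z" "W \<bowtie> i # k # Z" "W \<bowtie> j # k # Z'" "y \<bowtie> k # j # Z'"
      using ik kj by (auto simp: lcm_rel_def)
    have "i # k # Z \<bowtie> j # k # Z'" using Z by (meson peq_sym peq_trans)
    then have L: "lcm_rel i j (k # Z) (k # Z')" using IH peq_length[OF Z(1)] by simp
    show ?thesis
    proof (cases "i = j")
      case True
      then have "k # Z \<bowtie> k # Z'" using L by (simp add: lcm_rel_def)
      \<comment> \<open>For equal first letters, \<open>lcm_rel\<close> amounts to left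
        cancellation.\<close>
      then have "lcm_rel k k Z Z'" using IH peq_length[OF Z(1)] by simp
      then have "Z \<bowtie> Z'" by (simp add: lcm_rel_def)
      then have "x \<bowtie> y" using Z True by (meson peq_Cons peq_sym peq_trans)
      then show ?thesis using True by (simp add: lcm_rel_eqI)
    next
      case False
      \<comment> \<open>Two distinct neighbours of \<open>k\<close> are \<open>k - 1\<close> and
        \<open>k + 1\<close>, so they commute; the three generators form type A_3 with
        \<open>k\<close> in the middle.\<close>
      then have ij: "far i j" using 4 by (auto simp: far_def adj_def)
      then obtain T where T: "k # Z \<bowtie> j # T" "k # Z' \<bowtie> i # T" using L by (auto simp: lcm_rel_def)
      have len_T: "length Z = length T" "length Z' = length T"
        using peq_length[OF T(1)] peq_length[OF T(2)] by auto
      have "lcm_rel k j Z T" "lcm_rel k i Z' T" using IH T peq_length[OF Z(1)] len_T by simp_all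
      then obtain S S' where S: "Z \<bowtie> j # k # S" "T \<bowtie> k # j # S" "Z' \<bowtie> i # k # S'" "T \<bowtie> k # i # S'"
        using 4 adj_sym[OF 4(1)] by (auto simp: lcm_rel_def)
      have "k # j # S \<bowtie> k # i # S'" using S by (meson peq_sym peq_trans)
      then have "lcm_rel k k (j # S) (i # S')"
        using IH peq_length[OF Z(1)] peq_length[OF S(1)] by simp
      then have "j # S \<bowtie> i # S'" by (simp add: lcm_rel_def)
      then have "lcm_rel j i S S'" using IH peq_length[OF Z(1)] peq_length[OF S(1)] by simp
      then obtain R where R: "S \<bowtie> i # R" "S' \<bowtie> j # R" using far_sym[OF ij] by (auto simp: lcm_rel_def)
      have "x \<bowtie> k # i # Z" by fact
      also have "\<dots> \<bowtie> k # i # j # k # S" using S by (intro peq_Cons)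
      also have "\<dots> \<bowtie> k # i # j # k # i # R" using R by (intro peq_Cons)
      also have "\<dots> \<bowtie> k # j # i # k # i # R" using ij by (intro peq_Cons peq_far)
      also have "\<dots> \<bowtie> k # j # k # i # k # R" using 4 by (intro peq_Cons peq_adj)
      also have "\<dots> \<bowtie> j # k # j # i # k # R" using 4 by (intro peq_adj)
      finally have x: "x \<bowtie> j # k # j # i # k # R" .
      have "y \<bowtie> k # j # Z'" by fact
      also have "\<dots> \<bowtie> k # j # i # k # S'" using S by (intro peq_Cons)
      also have "\<dots> \<bowtie> k # j # i # k # j # R" using R by (intro peq_Cons)
      also have "\<dots> \<bowtie> k # i # j # k # j # R" using ij far_sym by (intro peq_Cons peq_far) auto
      also have "\<dots> \<bowtie> k # i # k # j # k # R" using 4 adj_sym by (intro peq_Cons peq_adj) auto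
      also have "\<dots> \<bowtie> i # k # i # j # k # R" using 4 adj_sym by (intro peq_adj) auto
      also have "\<dots> \<bowtie> i # k # j # i # k # R" using ij by (intro peq_Cons peq_far)
      finally show ?thesis using ij x by (intro lcm_rel_farI)
    qed
  qed
qed

text \<open>Outer induction on the length, inner induction along the derivation: the first letter of
  every intermediate word is related to \<open>i\<close>, and \<open>lcm_rel_trans\<close> extends
  this by one relation.\<close>

theorem garside_lcm: "i # x \<bowtie> j # y \<Longrightarrow> lcm_rel i j x y"
proof (induction "length x" arbitrary: i j x y rule: less_induct)
  case less
  have "\<exists>k V. W = k # V \<and> length V = length x \<and> lcm_rel i k x V" if "i # x \<bowtie> W" for W
    using that
  proof (induction rule: rtranclp_induct)
    case base
    show ?case using lcm_rel_eqI by auto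
  next
    case (step W W')
    then obtain k V where V: "W = k # V" "length V = length x" "lcm_rel i k x V" by blast
    have "length W' = length W" using step.hyps(2) by (metis peq_length r_into_rtranclp)
    then obtain l V' where V': "W' = l # V'" "length V' = length x" using V by (cases W') auto
    have "lcm_rel k l V V'" using step.hyps(2) V V' by (simp add: pstep_lcm_rel)
    then have "lcm_rel i l x V'" using lcm_rel_trans[OF less.hyps] V V' by metis
    with V' show ?case by blast
  qed
  from this[OF less.prems] show ?case by simp
qed

lemma peq_cancel_left: "u @ v \<bowtie> u @ w \<Longrightarrow> v \<bowtie> w"
proof (induction u)
  case (Cons i u)
  from garside_lcm[of i "u @ v" i "u @ w"] Cons show ?case by (simp add: lcm_rel_def)
qed simp

lemma peq_cancel_right: "v @ u \<bowtie> w @ u \<Longrightarrow> v \<bowtie> w"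
  using peq_cancel_left[of "rev u" "rev v" "rev w"] peq_rev by (metis rev_append rev_rev_ident)

section \<open>Braids as fractions\<close>

lemma valid_word_simps [simp]:
  "valid_word n []"
  "valid_word n (p # w) \<longleftrightarrow> 1 \<le> fst p \<and> fst p < n \<and> valid_word n w"
  "valid_word n (u @ v) \<longleftrightarrow> valid_word n u \<and> valid_word n v"
  by (auto simp: valid_word_def)

lemma beq_valid: "beq n u v \<Longrightarrow> valid_word n u \<and> valid_word n v"
  by (induction rule: beq.induct) auto

declare beq_trans [trans]

lemma beq_context:
  "beq n u v \<Longrightarrow> valid_word n x \<Longrightarrow> valid_word n y \<Longrightarrow> beq n (x @ u @ y) (x @ v @ y)"
proof (induction rule: beq.induct)
  case (beq_cancel u v i b)
  then show ?case using beq.beq_cancel[of n "x @ u" "v @ y" i b] by simp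
next
  case (beq_comm u v i j)
  then show ?case using beq.beq_comm[of n "x @ u" "v @ y" i j] by simp
next
  case (beq_braid u v i)
  then show ?case using beq.beq_braid[of n "x @ u" "v @ y" i] by simp
qed (auto intro: beq.intros)

lemma beq_append: "beq n u u' \<Longrightarrow> beq n v v' \<Longrightarrow> beq n (u @ v) (u' @ v')"
  using beq_context[of n u u' "[]" v] beq_context[of n v v' u' "[]"] beq_valid
  by (metis append_Nil append_Nil2 beq_trans valid_word_simps(1))

definition inv_word :: "bword \<Rightarrow> bword" where
  "inv_word w = rev (map (\<lambda>(i, b). (i, \<not> b)) w)"

lemma inv_word_simps [simp]:
  "inv_word [] = []"
  "inv_word ((i, b) # w) = inv_word w @ [(i, \<not> b)]"
  "inv_word (u @ v) = inv_word v @ inv_word u"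
  by (simp_all add: inv_word_def)

lemma inv_word_inv_word [simp]: "inv_word (inv_word w) = w"
  by (induction w) auto

lemma valid_inv_word [simp]: "valid_word n (inv_word w) \<longleftrightarrow> valid_word n w"
  by (induction w) auto

lemma beq_append_inv_word: "valid_word n w \<Longrightarrow> beq n (w @ inv_word w) []"
proof (induction w)
  case (Cons p w)
  obtain i b where p: "p = (i, b)" by (cases p)
  with Cons have "beq n ([p] @ (w @ inv_word w) @ [(i, \<not> b)]) ([p] @ [] @ [(i, \<not> b)])"
    by (intro beq_context) auto
  also have "beq n \<dots> []" using beq_cancel[of n "[]" "[]" i b] p Cons.prems by simp
  finally show ?case using p by simp
qed (simp add: beq_refl)

lemma beq_inv_word_append: "valid_word n w \<Longrightarrow> beq n (inv_word w @ w) []"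
  using beq_append_inv_word[of n "inv_word w"] by simp

lemma beq_move_left:
  assumes "beq n (u @ v) w"
  shows "beq n v (inv_word u @ w)"
proof -
  have val: "valid_word n u" "valid_word n v" using beq_valid[OF assms] by auto
  have "beq n (inv_word u @ (u @ v)) (inv_word u @ w)"
    using assms val by (intro beq_append beq_refl) auto
  moreover have "beq n ((inv_word u @ u) @ v) ([] @ v)"
    using val by (intro beq_append beq_refl beq_inv_word_append) auto
  ultimately show ?thesis by (metis append.assoc append_Nil beq_sym beq_trans)
qed

text \<open>A list \<open>a\<close> of generator indices is read from right to left, so that \<open>i # a\<close> is the
  right multiple \<open>a \<sigma>\<^sub>i\<close>.\<close>
definition pword :: "nat list \<Rightarrow> bword" where
  "pword a = map (\<lambda>i. (i, True)) (rev a)"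

lemma pword_simps [simp]:
  "pword [] = []" "pword (i # a) = pword a @ [(i, True)]" "pword (a @ b) = pword b @ pword a"
  by (simp_all add: pword_def)

lemma valid_pword [simp]: "valid_word n (pword a) \<longleftrightarrow> set a \<subseteq> {1..<n}"
  by (auto simp: valid_word_def pword_def)

lemma pstep_beq:
  assumes "pstep a b" "set a \<subseteq> {1..<n}"
  shows "beq n (pword a) (pword b)"
  using assms
proof (induction rule: pstep.induct)
  case (pstep_far i j u v)
  then consider "i + 1 < j" | "j + 1 < i" by (auto simp: far_def)
  then show ?case
  proof cases
    case 1
    then show ?thesis using beq_sym[OF beq_comm[of n "pword v" "pword u" i j]] pstep_far by auto
  next
    case 2
    then show ?thesis using beq_comm[of n "pword v" "pword u" j i] pstep_far by auto
  qed
next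
  case (pstep_adj i j u v)
  then consider "j = i + 1" | "i = j + 1" by (auto simp: adj_def)
  then show ?case
  proof cases
    case 1
    then show ?thesis using beq_braid[of n "pword v" "pword u" i] pstep_adj by auto
  next
    case 2
    then show ?thesis using beq_sym[OF beq_braid[of n "pword v" "pword u" j]] pstep_adj by auto
  qed
qed

lemma peq_beq: "a \<bowtie> b \<Longrightarrow> set a \<subseteq> {1..<n} \<Longrightarrow> beq n (pword a) (pword b)"
proof (induction rule: rtranclp_induct)
  case (step b c)
  then show ?case using pstep_beq peq_set beq_trans by metis
qed (simp add: beq_refl)

section \<open>Centrality and divisibility of the full twist\<close>

lemma far_commute: "\<forall>j\<in>set u. far i j \<Longrightarrow> i # u \<bowtie> u @ [i]"
proof (induction u)
  case (Cons j u)
  then have "i # j # u \<bowtie> j # i # u" by (intro peq_far) simp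
  also have "\<dots> \<bowtie> j # u @ [i]" using Cons by (intro peq_Cons) simp
  finally show ?case by simp
qed simp

text \<open>The letter \<open>i\<close> passes the letters beyond \<open>i + 1\<close>, becomes
  \<open>i + 1\<close> by the braid relation, and passes the letters below \<open>i\<close>.\<close>

lemma coxeter_shift:
  assumes "1 \<le> i" "i + 1 < n"
  shows "[1..<n] @ [i] \<bowtie> (i + 1) # [1..<n]"
proof -
  have split: "[1..<n] = [1..<i] @ [i, i + 1] @ [i + 2..<n]"
    using assms upt_add_eq_append[of 1 i "n - i"] by (simp add: upt_conv_Cons)
  have "[1..<n] @ [i] = ([1..<i] @ [i, i + 1]) @ ([i + 2..<n] @ [i])" using split by simp
  also have "\<dots> \<bowtie> ([1..<i] @ [i, i + 1]) @ (i # [i + 2..<n])"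
    by (intro peq_append peq_sym[OF far_commute] rtranclp.rtrancl_refl) (auto simp: far_def)
  also have "\<dots> = [1..<i] @ ([i, i + 1, i] @ [i + 2..<n])" by simp
  also have "\<dots> \<bowtie> [1..<i] @ ([i + 1, i, i + 1] @ [i + 2..<n])"
    by (intro peq_append rtranclp.rtrancl_refl) (auto intro!: peq_adj simp: adj_def)
  also have "\<dots> = ([1..<i] @ [i + 1]) @ ([i, i + 1] @ [i + 2..<n])" by simp
  also have "\<dots> \<bowtie> ((i + 1) # [1..<i]) @ ([i, i + 1] @ [i + 2..<n])"
    by (intro peq_append peq_sym[OF far_commute] rtranclp.rtrancl_refl) (auto simp: far_def)
  also have "\<dots> = (i + 1) # [1..<n]" using split by simp
  finally show ?thesis .
qed

lemma coxeter_shift_list: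
  assumes "set u \<subseteq> {1..<n - 1}"
  shows "[1..<n] @ u \<bowtie> map Suc u @ [1..<n]"
  using assms
proof (induction u)
  case (Cons i u)
  have "[1..<n] @ i # u = ([1..<n] @ [i]) @ u" by simp
  also have "\<dots> \<bowtie> ((i + 1) # [1..<n]) @ u"
    using Cons.prems by (intro peq_append coxeter_shift) auto
  also have "\<dots> \<bowtie> (i + 1) # map Suc u @ [1..<n]"
    using Cons by (auto intro!: peq_Cons)
  finally show ?case by simp
qed simp

text \<open>The shift of \<open>coxeter_shift\<close> stops at \<open>n - 1\<close>; two copies of
  the Coxeter element carry this last generator back to the first. The part
  \<open>[1..<n - 1]\<close> of the second copy is shifted through the first copy.\<close>

lemma coxeter_square:
  assumes "2 \<le> n"
  shows "[1..<n] @ [1..<n] @ [n - 1] \<bowtie> 1 # [1..<n] @ [1..<n]"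
proof -
  have l: "[1..<n] = [1..<n - 1] @ [n - 1]" and f: "[1..<n] = 1 # [2..<n]"
    using assms upt_Suc_append[of 1 "n - 1"] by (auto simp: upt_conv_Cons numeral_2_eq_2)
  have s: "map Suc [1..<n - 1] = [2..<n]"
    using assms by (simp add: map_Suc_upt numeral_2_eq_2)
  have "1 # [1..<n] @ [1..<n] = 1 # ([1..<n] @ [1..<n - 1]) @ [n - 1]" using l by simp
  also have "\<dots> \<bowtie> 1 # (map Suc [1..<n - 1] @ [1..<n]) @ [n - 1]"
    by (intro peq_Cons peq_append coxeter_shift_list) auto
  also have "\<dots> = (1 # [2..<n]) @ [1..<n] @ [n - 1]" using s by simp
  also have "\<dots> = [1..<n] @ [1..<n] @ [n - 1]" using f by simp
  finally show ?thesis by (rule peq_sym)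
qed

definition coxeter_power :: "nat \<Rightarrow> nat \<Rightarrow> nat list" where
  "coxeter_power n k = concat (replicate k [1..<n])"

lemma coxeter_power_add: "coxeter_power n (k + l) = coxeter_power n k @ coxeter_power n l"
  by (simp add: coxeter_power_def replicate_add)

lemma set_coxeter_power: "set (coxeter_power n k) \<subseteq> {1..<n}"
  by (auto simp: coxeter_power_def)

lemma coxeter_power_shift:
  assumes "1 \<le> i" "i + k < n"
  shows "coxeter_power n k @ [i] \<bowtie> (i + k) # coxeter_power n k"
  using assms(2)
proof (induction k)
  case (Suc k)
  have "coxeter_power n (Suc k) @ [i] = [1..<n] @ (coxeter_power n k @ [i])"
    by (simp add: coxeter_power_def)
  also have "\<dots> \<bowtie> [1..<n] @ ((i + k) # coxeter_power n k)"
    using Suc by (intro peq_append Suc.IH rtranclp.rtrancl_refl) auto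
  also have "\<dots> = ([1..<n] @ [i + k]) @ coxeter_power n k" by simp
  also have "\<dots> \<bowtie> ((i + k + 1) # [1..<n]) @ coxeter_power n k"
    using Suc assms by (intro peq_append coxeter_shift) auto
  finally show ?case by (simp add: coxeter_power_def)
qed (simp add: coxeter_power_def)

text \<open>The \<open>n\<close>-th power of a Coxeter element is the square of Garside's half
  twist.\<close>

definition full_twist :: "nat \<Rightarrow> nat list" where
  "full_twist n = coxeter_power n n"

text \<open>The letter travels left through \<open>n\<close> copies: \<open>n - i - 1\<close> of
  them raise it from \<open>i\<close> to \<open>n - 1\<close>, two turn \<open>n - 1\<close> into 1,
  and \<open>i - 1\<close> raise 1 to \<open>i\<close>.\<close>

lemma full_twist_central_letter:
  assumes "1 \<le> i" "i < n"
  shows "full_twist n @ [i] \<bowtie> i # full_twist n"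
proof -
  have n: "n = (i - 1) + (2 + (n - i - 1))" using assms by simp
  let ?C = "coxeter_power n"
  have C2: "?C 2 = [1..<n] @ [1..<n]" by (simp add: coxeter_power_def numeral_2_eq_2)
  have "full_twist n @ [i] = ?C (i - 1) @ ?C 2 @ (?C (n - i - 1) @ [i])"
    unfolding full_twist_def by (subst (2) n) (simp only: coxeter_power_add append.assoc)
  also have "\<dots> \<bowtie> ?C (i - 1) @ ?C 2 @ ((i + (n - i - 1)) # ?C (n - i - 1))"
    using assms by (intro peq_append coxeter_power_shift rtranclp.rtrancl_refl) auto
  also have "\<dots> = ?C (i - 1) @ ([1..<n] @ [1..<n] @ [n - 1]) @ ?C (n - i - 1)"
    using assms by (simp add: C2)
  also have "\<dots> \<bowtie> ?C (i - 1) @ (1 # [1..<n] @ [1..<n]) @ ?C (n - i - 1)"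
    using assms by (intro peq_append coxeter_square rtranclp.rtrancl_refl) auto
  also have "\<dots> = (?C (i - 1) @ [1]) @ (?C 2 @ ?C (n - i - 1))" by (simp add: C2)
  also have "\<dots> \<bowtie> ((1 + (i - 1)) # ?C (i - 1)) @ (?C 2 @ ?C (n - i - 1))"
    using assms by (intro peq_append coxeter_power_shift rtranclp.rtrancl_refl) auto
  also have "\<dots> = i # (?C (i - 1) @ ?C 2 @ ?C (n - i - 1))" using assms by simp
  also have "\<dots> = i # full_twist n"
    unfolding full_twist_def by (subst (5) n) (simp only: coxeter_power_add append.assoc)
  finally show ?thesis .
qed

lemma full_twist_central:
  assumes "set u \<subseteq> {1..<n}"
  shows "full_twist n @ u \<bowtie> u @ full_twist n"
  using assms
proof (induction u)
  case (Cons i u)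
  have "full_twist n @ i # u = (full_twist n @ [i]) @ u" by simp
  also have "\<dots> \<bowtie> (i # full_twist n) @ u"
    using Cons.prems by (intro peq_append full_twist_central_letter) auto
  also have "\<dots> \<bowtie> i # u @ full_twist n" using Cons by (auto intro!: peq_Cons)
  finally show ?case by simp
qed simp

text \<open>The first letter of the \<open>i\<close>-th copy moves to the front through the
  \<open>i - 1\<close> copies before it, which raise it from 1 to \<open>i\<close>.\<close>

lemma full_twist_divisible:
  assumes "1 \<le> i" "i < n"
  obtains y where "set y \<subseteq> {1..<n}" "full_twist n \<bowtie> i # y"
proof -
  have n: "n = (i - 1) + (1 + (n - i))" using assms by simp
  let ?C = "coxeter_power n"
  have C1: "?C 1 = 1 # [2..<n]"
  proof -
    have "?C 1 = [1..<n]" by (simp add: coxeter_power_def)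
    moreover have "1 < n" using assms by simp
    ultimately show ?thesis using upt_conv_Cons[of 1 n] by (simp only: Suc_1)
  qed
  have "full_twist n = ?C (i - 1) @ ?C 1 @ ?C (n - i)"
    unfolding full_twist_def by (subst (2) n) (simp only: coxeter_power_add append.assoc)
  also have "\<dots> = (?C (i - 1) @ [1]) @ ([2..<n] @ ?C (n - i))" by (simp only: C1) simp
  also have "\<dots> \<bowtie> ((1 + (i - 1)) # ?C (i - 1)) @ ([2..<n] @ ?C (n - i))"
    using assms by (intro peq_append coxeter_power_shift rtranclp.rtrancl_refl) auto
  finally have "full_twist n \<bowtie> i # (?C (i - 1) @ [2..<n] @ ?C (n - i))" using assms by simp
  moreover have "set (?C (i - 1) @ [2..<n] @ ?C (n - i)) \<subseteq> {1..<n}"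
    using set_coxeter_power by auto
  ultimately show ?thesis using that by blast
qed

lemma set_full_twist: "set (full_twist n) \<subseteq> {1..<n}"
  unfolding full_twist_def by (rule set_coxeter_power)

text \<open>Every braid is \<open>p\<^sup>-\<^sup>1 q\<close> with \<open>p\<close>, \<open>q\<close> positive: a letter \<open>\<sigma>\<^sub>i\<^sup>-\<^sup>1\<close> is absorbed by
  multiplying with the full twist, which is central and divisible by \<open>\<sigma>\<^sub>i\<close>.\<close>
lemma fraction:
  assumes "valid_word n w"
  shows "\<exists>p q. set p \<subseteq> {1..<n} \<and> set q \<subseteq> {1..<n} \<and> beq n (pword p @ w) (pword q)"
  using assms
proof (induction w rule: rev_induct)
  case Nil
  show ?case by (rule exI[of _ "[]"], rule exI[of _ "[]"]) (simp add: beq_refl)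
next
  case (snoc l w)
  then obtain p q where pq: "set p \<subseteq> {1..<n}" "set q \<subseteq> {1..<n}" "beq n (pword p @ w) (pword q)"
    by auto
  obtain i b where l: "l = (i, b)" by (cases l)
  with snoc.prems have i: "1 \<le> i" "i < n" by auto
  show ?case
  proof (cases b)
    case True
    have "beq n ((pword p @ w) @ [l]) (pword q @ [l])"
      using pq snoc.prems by (intro beq_append beq_refl) auto
    with l True have "beq n (pword p @ (w @ [l])) (pword (i # q))" by simp
    moreover have "set (i # q) \<subseteq> {1..<n}" using pq i by simp
    ultimately show ?thesis using pq(1) by blast
  next
    case False
    let ?z = "full_twist n"
    obtain y where y: "set y \<subseteq> {1..<n}" "?z \<bowtie> i # y" using full_twist_divisible i by blast
    have z: "set ?z \<subseteq> {1..<n}" by (rule set_full_twist)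
    \<comment> \<open>Centrality brings the divisor \<open>i\<close> of the full twist to the head
      of the list, that is to the end of the word, where it cancels \<open>l\<close>.\<close>
    have "q @ ?z \<bowtie> ?z @ q" using full_twist_central pq(2) peq_sym by blast
    also have "\<dots> \<bowtie> (i # y) @ q" using y by (intro peq_append) auto
    finally have zq: "beq n (pword (q @ ?z)) (pword (i # y @ q))"
      using pq(2) z by (intro peq_beq) auto
    have "beq n (pword ?z @ (pword p @ w) @ [l]) (pword ?z @ pword q @ [l])"
      using pq snoc.prems z by (intro beq_append beq_refl) auto
    also have "beq n ((pword ?z @ pword q) @ [l]) (pword (i # y @ q) @ [l])"
      using zq snoc.prems by (intro beq_append beq_refl) auto
    then have "beq n (pword ?z @ pword q @ [l]) (pword (y @ q) @ [(i, True), (i, False)] @ [])"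
      using l False by simp
    also have "beq n \<dots> (pword (y @ q) @ [])"
      using beq_cancel[of n "pword (y @ q)" "[]" i True] i y pq by simp
    finally have "beq n (pword (p @ ?z) @ (w @ [l])) (pword (y @ q))" by simp
    moreover have "set (p @ ?z) \<subseteq> {1..<n}" "set (y @ q) \<subseteq> {1..<n}" using pq z y by auto
    ultimately show ?thesis by blast
  qed
qed

text \<open>Each letter of \<open>p\<close> costs one full twist: it is completed to a full twist by
  a cofactor \<open>y\<close>, and centrality moves the twist past the rest of
  \<open>p\<close>.\<close>

lemma full_twist_power_multiple:
  assumes "set p \<subseteq> {1..<n}"
  obtains c k where "c @ p \<bowtie> concat (replicate k (full_twist n))"
proof -
  have "\<exists>c. c @ p \<bowtie> concat (replicate (length p) (full_twist n))"
    using assms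
  proof (induction p)
    case (Cons i p)
    then obtain c where c: "c @ p \<bowtie> concat (replicate (length p) (full_twist n))" by auto
    obtain y where y: "full_twist n \<bowtie> i # y"
      using full_twist_divisible[of i n] Cons.prems by (metis atLeastLessThan_iff insert_subset list.simps(15))
    \<comment> \<open>The cofactor is known only on the other side of \<open>i\<close>; centrality
      and left cancellation of \<open>i\<close> turn it round.\<close>
    have "y @ [i] \<bowtie> full_twist n"
    proof -
      have "i # y @ [i] \<bowtie> full_twist n @ [i]" using peq_append[OF peq_sym[OF y]] by fastforce
      also have "\<dots> \<bowtie> [i] @ full_twist n" using full_twist_central_letter[of i n] Cons.prems by simp
      finally show ?thesis using peq_cancel_left[of "[i]"] by simp
    qed
    then have "c @ (y @ [i]) @ p \<bowtie> c @ full_twist n @ p" by (intro peq_append) auto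
    also have "\<dots> \<bowtie> c @ p @ full_twist n"
      using Cons.prems by (intro peq_append full_twist_central) auto
    also have "\<dots> = (c @ p) @ full_twist n" by simp
    also have "\<dots> \<bowtie> concat (replicate (length p) (full_twist n)) @ full_twist n"
      using c by (intro peq_append) auto
    also have "\<dots> = concat (replicate (length p) (full_twist n) @ [full_twist n])" by simp
    also have "\<dots> = concat (replicate (length (i # p)) (full_twist n))"
      by (simp only: replicate_append_same) simp
    finally show ?case by (metis append.assoc append_Cons append_Nil)
  qed (auto intro: exI[of _ "[]"])
  then show ?thesis using that by blast
qed

text \<open>If \<open>c @ p\<close> is a power of the full twist, then \<open>q\<close> followed by
  this power is a multiple of \<open>p\<close>, and by centrality also of \<open>q\<close>.\<close>

lemma common_multiple:
  assumes "set p \<subseteq> {1..<n}" "set q \<subseteq> {1..<n}"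
  obtains c d \<Omega> where "set \<Omega> \<subseteq> {1..<n}" "c @ p \<bowtie> \<Omega>" "d @ q \<bowtie> \<Omega>"
proof -
  obtain c k where c: "c @ p \<bowtie> concat (replicate k (full_twist n))"
    using full_twist_power_multiple[OF assms(1)] by blast
  let ?z = "concat (replicate k (full_twist n))"
  have "q @ c @ p \<bowtie> q @ ?z" using c by (intro peq_append) auto
  moreover have "?z @ q \<bowtie> q @ ?z"
  proof (induction k)
    case (Suc k)
    have "full_twist n @ (concat (replicate k (full_twist n)) @ q)
        \<bowtie> full_twist n @ (q @ concat (replicate k (full_twist n)))"
      using Suc by (intro peq_append[OF rtranclp.rtrancl_refl])
    also have "\<dots> = (full_twist n @ q) @ concat (replicate k (full_twist n))" by simp
    also have "\<dots> \<bowtie> (q @ full_twist n) @ concat (replicate k (full_twist n))"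
      using assms by (intro peq_append full_twist_central) auto
    finally show ?case by simp
  qed simp
  moreover have "set (q @ ?z) \<subseteq> {1..<n}" using assms set_full_twist by (auto simp: set_replicate_conv_if split: if_splits)
  ultimately show ?thesis using that[of "q @ ?z" "q @ c" ?z] by simp
qed

section \<open>Comparison of braids\<close>

definition pclass :: "nat list \<Rightarrow> nat list set" where
  "pclass a = {b. a \<bowtie> b}"

lemma pclass_eq_iff: "pclass a = pclass b \<longleftrightarrow> a \<bowtie> b"
  unfolding pclass_def using peq_sym peq_trans by blast

text \<open>As lists are read from right to left, these are left divisors: the word of
  \<open>b\<close> begins a word for \<Omega>.\<close>

definition divisor :: "nat list \<Rightarrow> nat list \<Rightarrow> bool" where
  "divisor \<Omega> b \<longleftrightarrow> (\<exists>c. c @ b \<bowtie> \<Omega>)"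

lemma divisor_tail: "divisor \<Omega> (i # a) \<Longrightarrow> divisor \<Omega> a"
  unfolding divisor_def by (metis append.assoc append_Cons append_Nil)

lemma divisor_peq: "a \<bowtie> b \<Longrightarrow> divisor \<Omega> b \<Longrightarrow> divisor \<Omega> a"
  unfolding divisor_def by (meson peq_append peq_trans rtranclp.rtrancl_refl)

lemma divisor_set: "divisor \<Omega> a \<Longrightarrow> set a \<subseteq> set \<Omega>"
  unfolding divisor_def using peq_set by fastforce

lemma divisor_length: "divisor \<Omega> a \<Longrightarrow> length a \<le> length \<Omega>"
  unfolding divisor_def using peq_length by fastforce

text \<open>It suffices to require that the upper endpoint divides \<Omega>; the lower one then does
  so by \<open>divisor_tail\<close>.\<close>

definition edge :: "nat list \<Rightarrow> nat \<Rightarrow> nat list set \<Rightarrow> nat list set \<Rightarrow> bool" where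
  "edge \<Omega> i A B \<longleftrightarrow> (\<exists>a. A = pclass a \<and> B = pclass (i # a) \<and> divisor \<Omega> (i # a))"

lemma edgeI: "divisor \<Omega> (i # a) \<Longrightarrow> edge \<Omega> i (pclass a) (pclass (i # a))"
  by (auto simp: edge_def)

lemma edge_pclass_iff:
  "edge \<Omega> i (pclass a) B \<longleftrightarrow> B = pclass (i # a) \<and> divisor \<Omega> (i # a)"
  unfolding edge_def pclass_eq_iff by (metis divisor_peq pclass_eq_iff peq_Cons)

lemma edgeE:
  assumes "edge \<Omega> i A B"
  obtains a where "A = pclass a" "B = pclass (i # a)" "divisor \<Omega> (i # a)"
  using assms by (auto simp: edge_def)

lemma edge_lcm_rel:
  assumes "edge \<Omega> i (pclass a) C" "edge \<Omega> j (pclass b) C"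
  shows "lcm_rel i j a b" "divisor \<Omega> (i # a)"
  using assms garside_lcm by (auto simp: edge_pclass_iff pclass_eq_iff)

text \<open>The cofactors of \<open>i # a\<close> and \<open>j # a\<close> in \<open>\<Omega>\<close> are compared by the reversed form of
  Garside's lemma.\<close>
lemma divisor_lcm:
  assumes "divisor \<Omega> (i # a)" "divisor \<Omega> (j # a)"
  shows "far i j \<Longrightarrow> divisor \<Omega> (i # j # a)"
    and "adj i j \<Longrightarrow> divisor \<Omega> (i # j # i # a)"
proof -
  obtain c d where c: "c @ i # a \<bowtie> \<Omega>" and d: "d @ j # a \<bowtie> \<Omega>"
    using assms by (auto simp: divisor_def)
  have "(c @ [i]) @ a \<bowtie> (d @ [j]) @ a" using peq_trans[OF c peq_sym[OF d]] by simp
  then have "c @ [i] \<bowtie> d @ [j]" by (rule peq_cancel_right)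
  from peq_rev[OF this] have l: "lcm_rel i j (rev c) (rev d)" by (simp add: garside_lcm)
  have *: "divisor \<Omega> (u @ j # a)" if "rev d \<bowtie> rev u @ z" for u z
  proof -
    have "d \<bowtie> rev z @ u" using peq_rev[OF that] by simp
    then have "(rev z @ u) @ j # a \<bowtie> d @ j # a" by (intro peq_append peq_sym[of d]) auto
    with d have "rev z @ u @ j # a \<bowtie> \<Omega>" by (metis append.assoc peq_trans)
    then show ?thesis by (auto simp: divisor_def)
  qed
  show "divisor \<Omega> (i # j # a)" if "far i j"
    using l that *[of "[i]"] by (auto simp: lcm_rel_def)
  show "divisor \<Omega> (i # j # i # a)" if ij: "adj i j"
  proof -
    obtain z where "rev d \<bowtie> i # j # z" using l ij by (auto simp: lcm_rel_def)
    then have "divisor \<Omega> (j # i # j # a)" using *[of "[j, i]" z] by simp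
    then show ?thesis using divisor_peq peq_adj[OF ij] by blast
  qed
qed

text \<open>Squares and hexagons below a vertex come from Garside's lemma, those above a vertex from
  \<open>divisor_lcm\<close>. Termination and finiteness hold because divisors have bounded length
  and use only letters of \<Omega>.\<close>

interpretation divisors: braid_graph "edge \<Omega>" for \<Omega>
proof
  fix i j A B C
  show "A = B" if "edge \<Omega> i A C" "edge \<Omega> i B C"
    using that by (elim edgeE) (metis pclass_eq_iff peq_cancel_left append_Cons append_Nil)
  show "B = C" if "edge \<Omega> i A B" "edge \<Omega> i A C"
    using that by (elim edgeE) (metis pclass_eq_iff peq_Cons)
  show "\<exists>D. edge \<Omega> j A D \<and> edge \<Omega> i D C" if ij: "far i j" and e: "edge \<Omega> i A B" "edge \<Omega> j B C"
  proof -
    obtain a where a: "A = pclass a" "C = pclass (j # i # a)" "divisor \<Omega> (j # i # a)"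
      using e by (elim edgeE[of \<Omega> i]) (auto simp: edge_pclass_iff)
    have "i # j # a \<bowtie> j # i # a" using ij by (rule peq_far)
    then have "C = pclass (i # j # a)" "divisor \<Omega> (i # j # a)"
      using a divisor_peq pclass_eq_iff by metis+
    then show ?thesis using a edgeI divisor_tail by blast
  qed
  show "\<exists>D. edge \<Omega> j D A \<and> edge \<Omega> i D B" if ij: "far i j" and e: "edge \<Omega> i A C" "edge \<Omega> j B C"
  proof -
    obtain a b where ab: "A = pclass a" "B = pclass b" using e by (metis edgeE)
    with e have l: "lcm_rel i j a b" and div: "divisor \<Omega> (i # a)" "divisor \<Omega> (j # b)"
      using edge_lcm_rel by blast+
    then obtain z where z: "a \<bowtie> j # z" "b \<bowtie> i # z" using ij by (auto simp: lcm_rel_def)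
    then have "divisor \<Omega> (j # z)" "divisor \<Omega> (i # z)"
      using div divisor_tail divisor_peq peq_sym by meson+
    then have "edge \<Omega> j (pclass z) (pclass (j # z))" "edge \<Omega> i (pclass z) (pclass (i # z))"
      by (simp_all add: edgeI)
    moreover have "A = pclass (j # z)" "B = pclass (i # z)" using ab z by (simp_all add: pclass_eq_iff)
    ultimately show ?thesis by metis
  qed
  show "\<exists>D. edge \<Omega> j B D \<and> edge \<Omega> i C D" if ij: "far i j" and e: "edge \<Omega> i A B" "edge \<Omega> j A C"
  proof -
    obtain a where a: "A = pclass a" "B = pclass (i # a)" "C = pclass (j # a)"
        "divisor \<Omega> (i # a)" "divisor \<Omega> (j # a)"
      using e by (elim edgeE[of \<Omega> i]) (auto simp: edge_pclass_iff)
    have d: "divisor \<Omega> (i # j # a)" using divisor_lcm(1)[OF a(4,5) ij] .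
    have "j # i # a \<bowtie> i # j # a" by (rule peq_far[OF far_sym[OF ij]])
    then have "pclass (j # i # a) = pclass (i # j # a)" "divisor \<Omega> (j # i # a)"
      by (simp_all add: pclass_eq_iff divisor_peq[OF _ d])
    then show ?thesis using a d edgeI by metis
  qed
  show "\<exists>D P Q. edge \<Omega> i D P \<and> edge \<Omega> j P A \<and> edge \<Omega> j D Q \<and> edge \<Omega> i Q B"
    if ij: "adj i j" and e: "edge \<Omega> i A C" "edge \<Omega> j B C"
  proof -
    obtain a b where ab: "A = pclass a" "B = pclass b" using e by (metis edgeE)
    with e have l: "lcm_rel i j a b" and div: "divisor \<Omega> (i # a)" "divisor \<Omega> (j # b)"
      using edge_lcm_rel by blast+
    then obtain z where z: "a \<bowtie> j # i # z" "b \<bowtie> i # j # z" using ij by (auto simp: lcm_rel_def)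
    then have "divisor \<Omega> (j # i # z)" "divisor \<Omega> (i # j # z)"
      using div divisor_tail divisor_peq peq_sym by meson+
    moreover have "A = pclass (j # i # z)" "B = pclass (i # j # z)"
      using ab z by (simp_all add: pclass_eq_iff)
    ultimately show ?thesis using edgeI divisor_tail by metis
  qed
  show "\<exists>D P Q. edge \<Omega> j B P \<and> edge \<Omega> i P D \<and> edge \<Omega> i C Q \<and> edge \<Omega> j Q D"
    if ij: "adj i j" and e: "edge \<Omega> i A B" "edge \<Omega> j A C"
  proof -
    obtain a where a: "A = pclass a" "B = pclass (i # a)" "C = pclass (j # a)"
        "divisor \<Omega> (i # a)" "divisor \<Omega> (j # a)"
      using e by (elim edgeE[of \<Omega> i]) (auto simp: edge_pclass_iff)
    have d: "divisor \<Omega> (i # j # i # a)" using divisor_lcm(2)[OF a(4,5) ij] .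
    have "j # i # j # a \<bowtie> i # j # i # a" by (rule peq_adj[OF adj_sym[OF ij]])
    then have "pclass (j # i # j # a) = pclass (i # j # i # a)" "divisor \<Omega> (j # i # j # a)"
      by (simp_all add: pclass_eq_iff divisor_peq[OF _ d])
    then show ?thesis using a d edgeI divisor_tail by metis
  qed
next
  \<comment> \<open>Equivalent lists have equal length, so any representative measures the height of
    a vertex.\<close>
  define len :: "nat list set \<Rightarrow> nat" where "len A = length (SOME a. a \<in> A)" for A
  have len: "len (pclass a) = length a" for a
  proof -
    have "a \<in> pclass a" by (simp add: pclass_def)
    then have "(SOME b. b \<in> pclass a) \<in> pclass a" by (rule someI)
    then show ?thesis unfolding len_def using peq_length by (auto simp: pclass_def)
  qed
  show "wfp (\<lambda>B A. \<exists>i. edge \<Omega> i A B)"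
  proof (rule wfp_if_convertible_to_nat[of _ "\<lambda>A. length \<Omega> - len A"])
    fix A B assume "\<exists>i. edge \<Omega> i A B"
    then show "length \<Omega> - len B < length \<Omega> - len A"
      using divisor_length by (fastforce elim!: edgeE simp: len)
  qed
next
  let ?S = "pclass ` {a. set a \<subseteq> set \<Omega> \<and> length a \<le> length \<Omega>}"
  have "A \<in> ?S \<and> B \<in> ?S" if edge: "edge \<Omega> i A B" for i A B
  proof -
    obtain a where a: "A = pclass a" "B = pclass (i # a)" "divisor \<Omega> (i # a)"
      using edge by (rule edgeE)
    then have "divisor \<Omega> a" by (metis divisor_tail)
    then show ?thesis using a divisor_set divisor_length by blast
  qed
  then have "{(A, B). \<exists>i. edge \<Omega> i A B} \<subseteq> ?S \<times> ?S" by blast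
  moreover have "finite ?S" by (intro finite_imageI finite_lists_length_le) simp
  ultimately show "finite {(A, B). \<exists>i. edge \<Omega> i A B}" by (meson finite_SigmaI finite_subset)
qed

section \<open>Words spelled by paths\<close>

lemma edge_beq:
  assumes "edge \<Omega> i (pclass a) (pclass b)" "set \<Omega> \<subseteq> {1..<n}"
  shows "1 \<le> i" "i < n" "beq n (pword a @ [(i, True)]) (pword b)"
    "beq n (pword b @ [(i, False)]) (pword a)"
proof -
  have e: "b \<bowtie> i # a" "divisor \<Omega> (i # a)"
    using assms(1) by (simp_all add: edge_pclass_iff pclass_eq_iff)
  then have s: "set (i # a) \<subseteq> {1..<n}" using divisor_set assms(2) by blast
  then show i: "1 \<le> i" "i < n" by auto
  show *: "beq n (pword a @ [(i, True)]) (pword b)"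
    using peq_beq[OF peq_sym[OF e(1)] s] by simp
  have "beq n (pword b @ [(i, False)]) ((pword a @ [(i, True)]) @ [(i, False)])"
    using i by (intro beq_append beq_sym[OF *] beq_refl) auto
  also have "beq n \<dots> (pword a)"
    using beq_cancel[of n "pword a" "[]" i True] s by simp
  finally show "beq n (pword b @ [(i, False)]) (pword a)" .
qed

lemma nonneg_word:
  assumes "divisors.nonneg \<Omega> m (pclass a) (pclass b)" "set \<Omega> \<subseteq> {1..<n}" "set a \<subseteq> {1..<n}"
  shows "\<exists>u. valid_word n u \<and> (\<forall>p\<in>set u. fst p \<le> m) \<and> (m, False) \<notin> set u \<and>
    beq n (pword a @ u) (pword b)"
proof -
  \<comment> \<open>Induction along the path needs a free endpoint; its representative is exchanged
    for \<open>b\<close> at the end.\<close>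
  have "\<exists>b u. B = pclass b \<and> valid_word n u \<and> (\<forall>p\<in>set u. fst p \<le> m) \<and> (m, False) \<notin> set u \<and>
    beq n (pword a @ u) (pword b)" if "divisors.nonneg \<Omega> m (pclass a) B" for B
    using that unfolding divisors.nonneg_def
  proof (induction rule: rtranclp_induct)
    case base
    show ?case
      by (rule exI[of _ a], rule exI[of _ "[]"]) (use assms(3) in \<open>simp add: beq_refl\<close>)
  next
    case (step B C)
    then obtain b u where u: "B = pclass b" "valid_word n u" "\<forall>p\<in>set u. fst p \<le> m"
      "(m, False) \<notin> set u" "beq n (pword a @ u) (pword b)" by blast
    have extend: ?case if "C = pclass c" "beq n (pword b @ [l]) (pword c)" "fst l \<le> m" "l \<noteq> (m, False)"
      for c l
    proof (intro exI conjI)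
      have l: "valid_word n [l]" using beq_valid[OF that(2)] by simp
      then have "beq n ((pword a @ u) @ [l]) (pword b @ [l])"
        using u by (intro beq_append beq_refl)
      also note that(2)
      finally show "beq n (pword a @ (u @ [l])) (pword c)" by simp
      show "valid_word n (u @ [l])" using u l by simp
    qed (use that u in auto)
    have "(\<exists>i\<le>m. edge \<Omega> i B C) \<or> (\<exists>i<m. edge \<Omega> i C B)"
    proof -
      from step.hyps(2) have "divisors.link \<Omega> m B C \<or> edge \<Omega> m B C" by simp
      then show ?thesis unfolding divisors.link_def using less_imp_le by blast
    qed
    then consider i where "i \<le> m" "edge \<Omega> i B C" | i where "i < m" "edge \<Omega> i C B" by blast
    then show ?case
    proof cases
      case 1
      then have "C = pclass (i # b)" using u(1) by (simp add: edge_pclass_iff)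
      with 1 u(1) edge_beq(3)[OF _ assms(2)] show ?thesis by (intro extend[of _ "(i, True)"]) auto
    next
      case 2
      then obtain c where "C = pclass c" by (metis edgeE)
      with 2 u(1) edge_beq(4)[OF _ assms(2)] show ?thesis by (intro extend[of _ "(i, False)"]) auto
    qed
  qed
  from this[OF assms(1)] obtain b' u where u: "b \<bowtie> b'" "valid_word n u" "\<forall>p\<in>set u. fst p \<le> m"
      "(m, False) \<notin> set u" "beq n (pword a @ u) (pword b')" by (auto simp: pclass_eq_iff)
  then have "beq n (pword b') (pword b)"
    using beq_valid[OF u(5)] by (intro peq_beq peq_sym[OF u(1)]) simp
  with u show ?thesis using beq_trans by blast
qed

lemma pos_word:
  assumes "divisors.pos \<Omega> m (pclass a) (pclass b)" "set \<Omega> \<subseteq> {1..<n}" "set a \<subseteq> {1..<n}"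
  shows "\<exists>u. valid_word n u \<and> ipos_word m u \<and> beq n (pword a @ u) (pword b)"
proof -
  obtain A B where AB: "divisors.nonneg \<Omega> m (pclass a) A" "edge \<Omega> m A B"
    "divisors.nonneg \<Omega> m B (pclass b)"
    using assms(1) by (auto simp: divisors.pos_def)
  obtain x where x: "A = pclass x" "B = pclass (m # x)" "divisor \<Omega> (m # x)"
    using AB(2) by (rule edgeE)
  have sx: "set (m # x) \<subseteq> {1..<n}" using x(3) divisor_set assms(2) by blast
  obtain u where u: "valid_word n u" "\<forall>p\<in>set u. fst p \<le> m" "(m, False) \<notin> set u"
    "beq n (pword a @ u) (pword x)"
    using nonneg_word[OF AB(1)[unfolded x] assms(2,3)] by blast
  obtain v where v: "valid_word n v" "\<forall>p\<in>set v. fst p \<le> m" "(m, False) \<notin> set v"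
    "beq n (pword (m # x) @ v) (pword b)"
    using nonneg_word[OF AB(3)[unfolded x] assms(2) sx] by blast
  let ?u = "u @ [(m, True)] @ v"
  have valid: "valid_word n ([(m, True)] @ v)" using sx v by simp
  have "beq n ((pword a @ u) @ [(m, True)] @ v) (pword x @ [(m, True)] @ v)"
    using u valid by (intro beq_append beq_refl)
  also have "beq n (pword x @ [(m, True)] @ v) (pword b)" using v by simp
  finally have "beq n (pword a @ ?u) (pword b)" by simp
  moreover have "valid_word n ?u" using u valid by simp
  moreover from this have "ipos_word m ?u" using u v by (auto simp: ipos_word_def valid_word_def)
  ultimately show ?thesis by blast
qed

lemma beq_cancel_left: "beq n (x @ u) z \<Longrightarrow> beq n (x @ v) z \<Longrightarrow> beq n u v"
  using beq_move_left beq_sym beq_trans by blast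

text \<open>Write \<open>w\<close> as a fraction with denominator \<open>p\<close> and numerator
  \<open>q\<close>. A path from \<open>p\<close> to \<open>q\<close> among the divisors of a common
  multiple spells a word for \<open>w\<close>; \<open>irrefl\<close> excludes closed positive paths,
  so \<open>comparable\<close> yields a path of definite sign.\<close>

theorem trichotomy:
  assumes irrefl: "\<And>i u. valid_word n u \<Longrightarrow> ipos_word i u \<Longrightarrow> \<not> beq n u []"
    and w: "valid_word n w"
  shows "beq n w [] \<or>
    (\<exists>i u. valid_word n u \<and> ipos_word i u \<and> (beq n w u \<or> beq n (inv_word w) u))"
proof -
  obtain p q where pq: "set p \<subseteq> {1..<n}" "set q \<subseteq> {1..<n}" "beq n (pword p @ w) (pword q)"
    using fraction[OF w] by blast
  obtain c d \<Omega> where \<Omega>: "set \<Omega> \<subseteq> {1..<n}" "c @ p \<bowtie> \<Omega>" "d @ q \<bowtie> \<Omega>"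
    by (rule common_multiple[OF pq(1,2)])
  have acyclic: "\<not> divisors.pos \<Omega> m A A" for m A
  proof
    assume "divisors.pos \<Omega> m A A"
    \<comment> \<open>The closed path is rotated to start at the source of an edge labelled
      \<open>m\<close>, which is represented by a list with letters in range.\<close>
    then obtain x where x: "divisors.pos \<Omega> m (pclass x) (pclass x)" "divisor \<Omega> (m # x)"
      unfolding divisors.pos_def by (metis divisors.nonneg_refl divisors.nonneg_trans edgeE)
    then have "set x \<subseteq> {1..<n}" using divisor_set \<Omega>(1) by fastforce
    from pos_word[OF x(1) \<Omega>(1) this] obtain u where
      u: "valid_word n u" "ipos_word m u" "beq n (pword x @ u) (pword x)" by blast
    have "beq n (pword x @ []) (pword x)" using \<open>set x \<subseteq> {1..<n}\<close> by (simp add: beq_refl)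
    with u show False using beq_cancel_left irrefl by blast
  qed
  have conn: "(divisors.link \<Omega> n)\<^sup>*\<^sup>* (pclass []) (pclass a)" if "divisor \<Omega> a" for a
    using that
  proof (induction a)
    case (Cons i a)
    have "i < n" using divisor_set[OF Cons.prems] \<Omega>(1) by auto
    then have "divisors.link \<Omega> n (pclass a) (pclass (i # a))"
      using divisors.linkI(1) edgeI Cons.prems by blast
    with Cons.IH[OF divisor_tail[OF Cons.prems]] show ?case by (rule rtranclp.rtrancl_into_rtrancl)
  qed simp
  have "divisor \<Omega> p" "divisor \<Omega> q" using \<Omega> by (auto simp: divisor_def)
  then have "(divisors.link \<Omega> n)\<^sup>*\<^sup>* (pclass p) (pclass q)"
    using rtranclp_trans[OF divisors.conn_sym[OF conn] conn] by blast
  from divisors.comparable[OF acyclic this] consider "p \<bowtie> q"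
    | m where "divisors.pos \<Omega> m (pclass p) (pclass q)"
    | m where "divisors.pos \<Omega> m (pclass q) (pclass p)" by (auto simp: pclass_eq_iff)
  then show ?thesis
  proof cases
    case 1
    then have "beq n (pword p @ []) (pword q)" using peq_beq pq(1) by simp
    then show ?thesis using beq_cancel_left pq(3) by blast
  next
    case 2
    then show ?thesis using pos_word[OF 2 \<Omega>(1) pq(1)] beq_cancel_left pq(3) by blast
  next
    case 3
    then obtain u where u: "valid_word n u" "ipos_word m u" "beq n (pword q @ u) (pword p)"
      using pos_word[OF 3 \<Omega>(1) pq(2)] by blast
    have "beq n ((pword p @ w) @ u) (pword q @ u)" using pq u by (intro beq_append beq_refl) auto
    also note u(3)
    finally have "beq n (pword p @ (w @ u)) (pword p)" by simp
    moreover have "beq n (pword p @ []) (pword p)" using pq(1) by (simp add: beq_refl)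
    ultimately have "beq n (w @ u) []" by (rule beq_cancel_left)
    from beq_sym[OF beq_move_left[OF this]] u show ?thesis by auto
  qed
qed

section \<open>The least positive element of a normal subgroup\<close>

lemma bclass_eq_iff: "valid_word n u \<Longrightarrow> bclass n u = bclass n v \<longleftrightarrow> beq n u v"
  unfolding bclass_def using beq_refl beq_sym beq_trans by blast

lemma carrier_braid_group: "x \<in> carrier (braid_group n) \<longleftrightarrow> (\<exists>w. valid_word n w \<and> x = bclass n w)"
  by (auto simp: braid_group_def)

lemma bclass_in_carrier [simp]: "valid_word n w \<Longrightarrow> bclass n w \<in> carrier (braid_group n)"
  by (auto simp: carrier_braid_group)

lemma one_braid_group: "\<one>\<^bsub>braid_group n\<^esub> = bclass n []"
  by (simp add: braid_group_def)

text \<open>The product is defined by chosen representatives; since \<open>beq\<close> respects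
  concatenation, the choice does not matter.\<close>

lemma mult_bclass:
  assumes "valid_word n u" "valid_word n v"
  shows "bclass n u \<otimes>\<^bsub>braid_group n\<^esub> bclass n v = bclass n (u @ v)"
proof -
  have *: "beq n w (SOME a. a \<in> bclass n w)" if "valid_word n w" for w
    using someI[of "\<lambda>a. a \<in> bclass n w" w] beq_refl[OF that] by (simp add: bclass_def)
  have "beq n (u @ v) ((SOME a. a \<in> bclass n u) @ (SOME b. b \<in> bclass n v))"
    using assms * by (intro beq_append)
  then have "bclass n (u @ v) = bclass n ((SOME a. a \<in> bclass n u) @ (SOME b. b \<in> bclass n v))"
    using assms bclass_eq_iff[of n "u @ v"] by simp
  then show ?thesis by (simp add: braid_group_def)
qed

lemma group_braid_group: "group (braid_group n)"
proof (rule groupI)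
  fix x y z
  assume "x \<in> carrier (braid_group n)" "y \<in> carrier (braid_group n)" "z \<in> carrier (braid_group n)"
  then show "(x \<otimes>\<^bsub>braid_group n\<^esub> y) \<otimes>\<^bsub>braid_group n\<^esub> z =
      x \<otimes>\<^bsub>braid_group n\<^esub> (y \<otimes>\<^bsub>braid_group n\<^esub> z)"
    by (auto simp: carrier_braid_group mult_bclass)
next
  fix x assume "x \<in> carrier (braid_group n)"
  then obtain w where w: "valid_word n w" "x = bclass n w" by (auto simp: carrier_braid_group)
  have "bclass n (inv_word w) \<otimes>\<^bsub>braid_group n\<^esub> x = \<one>\<^bsub>braid_group n\<^esub>"
    using w beq_inv_word_append by (simp add: mult_bclass one_braid_group bclass_eq_iff)
  then show "\<exists>y\<in>carrier (braid_group n). y \<otimes>\<^bsub>braid_group n\<^esub> x = \<one>\<^bsub>braid_group n\<^esub>"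
    using w by (metis bclass_in_carrier valid_inv_word)
next
  fix x y assume "x \<in> carrier (braid_group n)" "y \<in> carrier (braid_group n)"
  then obtain u v where "valid_word n u" "x = bclass n u" "valid_word n v" "y = bclass n v"
    by (auto simp: carrier_braid_group)
  then show "x \<otimes>\<^bsub>braid_group n\<^esub> y \<in> carrier (braid_group n)" by (simp add: mult_bclass)
next
  fix x assume "x \<in> carrier (braid_group n)"
  then show "\<one>\<^bsub>braid_group n\<^esub> \<otimes>\<^bsub>braid_group n\<^esub> x = x"
    by (auto simp: carrier_braid_group mult_bclass one_braid_group)
qed (simp add: one_braid_group)

lemma inv_bclass:
  assumes "valid_word n w"
  shows "inv\<^bsub>braid_group n\<^esub> bclass n w = bclass n (inv_word w)"
  using assms beq_inv_word_append
  by (intro group.inv_equality[OF group_braid_group])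
    (simp_all add: mult_bclass one_braid_group bclass_eq_iff)

lemma sub_braid_carrier: "sub_braid n m \<subseteq> carrier (braid_group n)"
  by (auto simp: sub_braid_def)

lemma sub_braid_mult:
  "x \<in> sub_braid n m \<Longrightarrow> y \<in> sub_braid n m \<Longrightarrow> x \<otimes>\<^bsub>braid_group n\<^esub> y \<in> sub_braid n m"
  by (fastforce simp: sub_braid_def mult_bclass)

lemma sub_braid_inv: "x \<in> sub_braid n m \<Longrightarrow> inv\<^bsub>braid_group n\<^esub> x \<in> sub_braid n m"
  by (fastforce simp: sub_braid_def inv_bclass)

lemma sub_braid_mono: "k \<le> m \<Longrightarrow> sub_braid n k \<subseteq> sub_braid n m"
  by (fastforce simp: sub_braid_def valid_word_def)

lemma ipos_braid_sub_braid: "ipos_braid n i x \<Longrightarrow> x \<in> sub_braid n (i + 1)"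
  unfolding ipos_braid_def sub_braid_def ipos_word_def valid_word_def by fastforce

lemma ipos_braid_bounds: "ipos_braid n i x \<Longrightarrow> 1 \<le> i \<and> i < n"
  unfolding ipos_braid_def ipos_word_def valid_word_def by fastforce

lemma ipos_braid_pos: "ipos_braid n i x \<Longrightarrow> x \<in> dehornoy_pos n"
  by (auto simp: dehornoy_pos_def ipos_braid_def)

text \<open>Elements of \<open>sub_braid n i\<close> have words in letters below \<open>i\<close>,
  which leave the occurrences of \<open>i\<close> unchanged.\<close>

lemma ipos_braid_mult_sub_braid:
  assumes "ipos_braid n i x" "y \<in> sub_braid n i"
  shows "ipos_braid n i (x \<otimes>\<^bsub>braid_group n\<^esub> y)" "ipos_braid n i (y \<otimes>\<^bsub>braid_group n\<^esub> x)"
proof -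
  obtain u v where u: "valid_word n u" "bclass n u = x" "ipos_word i u"
    and v: "valid_word i v" "valid_word n v" "y = bclass n v"
    using assms by (auto simp: ipos_braid_def sub_braid_def)
  have "\<forall>p\<in>set v. 1 \<le> fst p \<and> fst p \<le> i" "(i, b) \<notin> set v" for b
    using v(1) by (auto simp: valid_word_def)
  then have "ipos_word i (u @ v)" "ipos_word i (v @ u)"
    using u(3) by (auto simp: ipos_word_def)
  with u v show "ipos_braid n i (x \<otimes>\<^bsub>braid_group n\<^esub> y)" "ipos_braid n i (y \<otimes>\<^bsub>braid_group n\<^esub> x)"
    unfolding ipos_braid_def by (metis mult_bclass valid_word_simps(3))+
qed

text \<open>For different indices, the factor of smaller index is absorbed by the other one.\<close>

lemma dehornoy_pos_mult:
  assumes "x \<in> dehornoy_pos n" "y \<in> dehornoy_pos n"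
  shows "x \<otimes>\<^bsub>braid_group n\<^esub> y \<in> dehornoy_pos n"
proof -
  obtain i j where ij: "ipos_braid n i x" "ipos_braid n j y"
    using assms by (auto simp: dehornoy_pos_def)
  consider "i = j" | "i < j" | "j < i" by linarith
  then show ?thesis
  proof cases
    case 1
    obtain u v where u: "valid_word n u" "bclass n u = x" "ipos_word i u"
      and v: "valid_word n v" "bclass n v = y" "ipos_word i v"
      using ij 1 by (auto simp: ipos_braid_def)
    have "ipos_word i (u @ v)" using u v by (auto simp: ipos_word_def)
    with u v have "ipos_braid n i (x \<otimes>\<^bsub>braid_group n\<^esub> y)"
      unfolding ipos_braid_def by (metis mult_bclass valid_word_simps(3))
    then show ?thesis by (rule ipos_braid_pos)
  next
    case 2
    then have "x \<in> sub_braid n j" using ipos_braid_sub_braid[OF ij(1)] sub_braid_mono[of "i + 1" j] by auto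
    with ij show ?thesis using ipos_braid_mult_sub_braid ipos_braid_pos by blast
  next
    case 3
    then have "y \<in> sub_braid n i" using ipos_braid_sub_braid[OF ij(2)] sub_braid_mono[of "j + 1" i] by auto
    with ij show ?thesis using ipos_braid_mult_sub_braid ipos_braid_pos by blast
  qed
qed

text \<open>That the identity is not positive means that no \<open>i\<close>-positive word is
  trivial, which is the assumption \<open>irrefl\<close> of \<open>trichotomy\<close>.\<close>

lemma dehornoy_trichotomy:
  assumes "\<one>\<^bsub>braid_group n\<^esub> \<notin> dehornoy_pos n" "x \<in> carrier (braid_group n)"
  shows "x = \<one>\<^bsub>braid_group n\<^esub> \<or> x \<in> dehornoy_pos n \<or> inv\<^bsub>braid_group n\<^esub> x \<in> dehornoy_pos n"
proof -
  have pos: "bclass n u \<in> dehornoy_pos n" if "valid_word n u" "ipos_word i u" for i u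
    using that by (intro ipos_braid_pos[of n i]) (auto simp: ipos_braid_def)
  then have irrefl: "\<not> beq n u []" if "valid_word n u" "ipos_word i u" for i u
    using that assms(1) by (metis bclass_eq_iff one_braid_group)
  obtain w where w: "valid_word n w" "x = bclass n w"
    using assms(2) by (auto simp: carrier_braid_group)
  have inv: "inv\<^bsub>braid_group n\<^esub> x = bclass n (inv_word w)" using w by (simp add: inv_bclass)
  have "beq n w [] \<or>
      (\<exists>i u. valid_word n u \<and> ipos_word i u \<and> (beq n w u \<or> beq n (inv_word w) u))"
    by (rule trichotomy[OF _ w(1)]) (rule irrefl)
  then consider "beq n w []"
    | i u where "valid_word n u" "ipos_word i u" "beq n w u"
    | i u where "valid_word n u" "ipos_word i u" "beq n (inv_word w) u" by blast
  then show ?thesis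
  proof cases
    case 1
    with w show ?thesis by (simp add: bclass_eq_iff one_braid_group)
  next
    case 2
    with w have "x = bclass n u" by (simp add: bclass_eq_iff)
    with 2 pos show ?thesis by simp
  next
    case 3
    with w inv have "inv\<^bsub>braid_group n\<^esub> x = bclass n u" by (simp add: bclass_eq_iff)
    with 3 pos show ?thesis by simp
  qed
qed

lemma sigma_power:
  assumes "1 < n"
  shows "sigma n 1 [^]\<^bsub>braid_group n\<^esub> (k :: nat) = bclass n (replicate k (1, True))"
proof (induction k)
  case 0
  interpret group "braid_group n" by (rule group_braid_group)
  show ?case by (simp add: one_braid_group)
next
  case (Suc k)
  interpret group "braid_group n" by (rule group_braid_group)
  have "valid_word n (replicate k (1, True))" using assms by (auto simp: valid_word_def)
  with Suc assms show ?case
    by (simp add: sigma_def mult_bclass replicate_append_same)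
qed

theorem theorem2p2:
  fixes n :: nat and N :: "bword set set"
  assumes "N \<lhd> braid_group n"
    and "N \<noteq> {\<one>\<^bsub>braid_group n\<^esub>}"
    and "discrete_on n N"
  shows "\<exists>m. least_positive n N m \<and>
    ((\<exists>k::nat. k > 0 \<and> m = sigma n 1 [^]\<^bsub>braid_group n\<^esub> k) \<or>
     (\<exists>r. 3 \<le> r \<and> r \<le> n \<and> N \<inter> sub_braid n (r - 1) = {\<one>\<^bsub>braid_group n\<^esub>} \<and>
          (\<forall>r'. 3 \<le> r' \<and> r' \<le> n \<and> N \<inter> sub_braid n (r' - 1) = {\<one>\<^bsub>braid_group n\<^esub>} \<longrightarrow> r' \<le> r) \<and>
          m \<in> centr n r))"
proof -
  define G where "G = braid_group n"
  define P where "P = dehornoy_pos n"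
  interpret normal N G using assms(1) by (simp add: G_def)
  note N_one = subgroup.one_closed[OF subgroup_axioms]
  note N_mult = subgroup.m_closed[OF subgroup_axioms]
  note N_inv = subgroup.m_inv_closed[OF subgroup_axioms]
  note P_mult = dehornoy_pos_mult[of _ n, folded G_def P_def]
  note sub_mult = sub_braid_mult[of _ n, folded G_def]
  note sub_inv = sub_braid_inv[of _ n, folded G_def]
  note sub_carrier = sub_braid_carrier[of n, folded G_def]
  note ipos_mult = ipos_braid_mult_sub_braid[of n, folded G_def]
  note ipos_P = ipos_braid_pos[of n, folded P_def]
  have dless: "dless n x y \<longleftrightarrow> inv\<^bsub>G\<^esub> x \<otimes>\<^bsub>G\<^esub> y \<in> P" if "x \<in> carrier G" "y \<in> carrier G" for x y
    using that by (simp add: dless_def G_def P_def)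
  have P_carrier: "P \<subseteq> carrier G" by (auto simp: P_def G_def dehornoy_pos_def)
  have dless_one: "dless n \<one>\<^bsub>G\<^esub> x \<longleftrightarrow> x \<in> P" if "x \<in> carrier G" for x
    using that by (simp add: dless)
  obtain h where h: "h \<in> N" "dless n \<one>\<^bsub>G\<^esub> h" "\<And>k. k \<in> N \<Longrightarrow> dless n \<one>\<^bsub>G\<^esub> k \<Longrightarrow> \<not> dless n k h"
    using bspec[OF assms(3)[unfolded discrete_on_def] N_one] by blast
  \<comment> \<open>Otherwise \<open>k = 1\<close> lies strictly between \<open>1\<close> and \<open>h\<close>.\<close>
  have one_notin_P: "\<one>\<^bsub>G\<^esub> \<notin> P"
    using h(3)[of "\<one>\<^bsub>G\<^esub>"] h(2) dless_one[of "\<one>\<^bsub>G\<^esub>"] by auto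
  have tri: "x = \<one>\<^bsub>G\<^esub> \<or> x \<in> P \<or> inv\<^bsub>G\<^esub> x \<in> P" if "x \<in> carrier G" for x
    using dehornoy_trichotomy[of n x] one_notin_P that by (simp add: G_def P_def)
  have hG: "h \<in> carrier G" using h(1) by (rule mem_carrier)
  have hP: "h \<in> P" using h(2) dless_one hG by simp
  have cancel: "x \<otimes>\<^bsub>G\<^esub> (inv\<^bsub>G\<^esub> x \<otimes>\<^bsub>G\<^esub> z) = z" "inv\<^bsub>G\<^esub> x \<otimes>\<^bsub>G\<^esub> (x \<otimes>\<^bsub>G\<^esub> z) = z"
    if "x \<in> carrier G" "z \<in> carrier G" for x z
    using that by (simp_all add: m_assoc[symmetric])
  have eq_if: "x = y" if "inv\<^bsub>G\<^esub> x \<otimes>\<^bsub>G\<^esub> y = \<one>\<^bsub>G\<^esub>" "x \<in> carrier G" "y \<in> carrier G" for x y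
    using inv_equality[OF that(1)] that(2,3) by (metis inv_inv inv_closed)
  \<comment> \<open>Nothing in \<open>N\<close> lies strictly between 1 and \<open>h\<close>; by
    \<open>tri\<close> this upgrades to \<open>h\<close> being below every other positive element of
    \<open>N\<close>.\<close>
  have least: "h = x \<or> inv\<^bsub>G\<^esub> h \<otimes>\<^bsub>G\<^esub> x \<in> P" if x: "x \<in> N" "x \<in> P" for x
  proof -
    have xG: "x \<in> carrier G" using x(1) by (rule mem_carrier)
    have "inv\<^bsub>G\<^esub> x \<otimes>\<^bsub>G\<^esub> h \<notin> P" using h(3)[OF x(1)] x(2) xG hG by (simp add: dless)
    moreover have "inv\<^bsub>G\<^esub> (inv\<^bsub>G\<^esub> h \<otimes>\<^bsub>G\<^esub> x) = inv\<^bsub>G\<^esub> x \<otimes>\<^bsub>G\<^esub> h"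
      using xG hG by (simp add: inv_mult_group)
    moreover have "h = x" if "inv\<^bsub>G\<^esub> h \<otimes>\<^bsub>G\<^esub> x = \<one>\<^bsub>G\<^esub>"
      using eq_if that xG hG by blast
    ultimately show ?thesis using tri[of "inv\<^bsub>G\<^esub> h \<otimes>\<^bsub>G\<^esub> x"] xG hG by auto
  qed
  have "least_positive n N h"
    unfolding least_positive_def G_def[symmetric] using h(1,2) least dless dless_one hG mem_carrier by metis
  moreover obtain i where i: "ipos_braid n i h" using hP by (auto simp: P_def dehornoy_pos_def)
  have bounds: "1 \<le> i" "i < n" using ipos_braid_bounds[OF i] by auto
  have h_sub: "h \<in> sub_braid n (i + 1)" using ipos_braid_sub_braid[OF i] .
  have trivial_meet: "z = \<one>\<^bsub>G\<^esub>" if z: "z \<in> N" "z \<in> sub_braid n i" for z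
  proof (rule ccontr)
    assume "z \<noteq> \<one>\<^bsub>G\<^esub>"
    \<comment> \<open>Multiplying \<open>h\<close> by the inverse of \<open>x\<close> keeps it
      \<open>i\<close>-positive, so a positive \<open>x\<close> would lie strictly between 1 and
      \<open>h\<close>. This applies to \<open>z\<close> and to its inverse.\<close>
    moreover have "x \<notin> P" if x: "x \<in> N" "x \<in> sub_braid n i" for x
    proof
      assume "x \<in> P"
      have xG: "x \<in> carrier G" using x(1) by (rule mem_carrier)
      have "inv\<^bsub>G\<^esub> x \<otimes>\<^bsub>G\<^esub> h \<in> P" using ipos_mult(2)[OF i sub_inv[OF x(2)]] by (rule ipos_P)
      then show False using h(3)[OF x(1)] \<open>x \<in> P\<close> xG hG by (simp add: dless)
    qed
    ultimately show False using tri[of z] z sub_inv[of z] N_inv[of z] mem_carrier by blast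
  qed
  have "(\<exists>k::nat. k > 0 \<and> h = sigma n 1 [^]\<^bsub>G\<^esub> k) \<or>
     (\<exists>r. 3 \<le> r \<and> r \<le> n \<and> N \<inter> sub_braid n (r - 1) = {\<one>\<^bsub>G\<^esub>} \<and>
          (\<forall>r'. 3 \<le> r' \<and> r' \<le> n \<and> N \<inter> sub_braid n (r' - 1) = {\<one>\<^bsub>G\<^esub>} \<longrightarrow> r' \<le> r) \<and>
          h \<in> centr n r)"
  proof (cases "i = 1")
    case True
    obtain w where w: "valid_word n w" "bclass n w = h" "ipos_word 1 w"
      using i True by (auto simp: ipos_braid_def)
    have "\<forall>p\<in>set w. p = (1, True)"
    proof
      fix p assume "p \<in> set w"
      with w(3) show "p = (1, True)" unfolding ipos_word_def by (cases p) (metis (full_types) fst_conv le_antisym)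
    qed
    then have "w = replicate (length w) (1, True)" by (intro replicate_eqI) auto
    then have "h = sigma n 1 [^]\<^bsub>G\<^esub> length w"
      using sigma_power[of n "length w"] bounds True w(2) by (simp add: G_def)
    moreover have "length w > 0" using w(3) by (auto simp: ipos_word_def)
    ultimately show ?thesis by blast
  next
    case False
    \<comment> \<open>This compares \<open>h\<close> with its conjugate by \<open>y\<close>, which
      lies in \<open>N\<close> and is again \<open>i\<close>-positive for \<open>y\<close> in
      \<open>sub_braid n i\<close>; minimality of \<open>h\<close> then makes \<open>a y\<close>
      trivial or positive.\<close>
    define a where "a y = inv\<^bsub>G\<^esub> h \<otimes>\<^bsub>G\<^esub> (y \<otimes>\<^bsub>G\<^esub> h \<otimes>\<^bsub>G\<^esub> inv\<^bsub>G\<^esub> y)" for y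
    have aN: "a y \<in> N" if "y \<in> carrier G" for y
      unfolding a_def using inv_op_closed2[OF that h(1)] h(1) by simp
    have a_cases: "a y = \<one>\<^bsub>G\<^esub> \<or> a y \<in> P" if y: "y \<in> sub_braid n i" for y
    proof -
      have yG: "y \<in> carrier G" using y sub_carrier by blast
      have "ipos_braid n i (y \<otimes>\<^bsub>G\<^esub> h \<otimes>\<^bsub>G\<^esub> inv\<^bsub>G\<^esub> y)" using ipos_mult i y sub_inv by blast
      then have "h = y \<otimes>\<^bsub>G\<^esub> h \<otimes>\<^bsub>G\<^esub> inv\<^bsub>G\<^esub> y \<or> a y \<in> P"
        unfolding a_def using least inv_op_closed2[OF yG h(1)] ipos_P by blast
      then show ?thesis unfolding a_def using hG by (metis l_inv)
    qed
    \<comment> \<open>The index can only be \<open>i\<close>: a smaller one would put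
      \<open>a y\<close> into the trivial intersection, and for a larger one \<open>j\<close> the
      inverse of \<open>a y\<close> would lie in \<open>sub_braid n j\<close>, making the identity
      \<open>j\<close>-positive.\<close>
    have a_ipos: "ipos_braid n i (a y)" if y: "y \<in> sub_braid n i" "a y \<in> P" for y
    proof -
      have yG: "y \<in> carrier G" using y sub_carrier by blast
      have "y \<in> sub_braid n (i + 1)" using y sub_braid_mono[of i "i + 1" n] by auto
      then have sub: "a y \<in> sub_braid n (i + 1)"
        unfolding a_def using h_sub by (intro sub_mult sub_inv)
      obtain j where j: "ipos_braid n j (a y)" using y(2) by (auto simp: P_def dehornoy_pos_def)
      have "\<not> j < i"
      proof
        assume "j < i"
        then have "a y \<in> sub_braid n i" using ipos_braid_sub_braid[OF j] sub_braid_mono[of "j + 1" i n] by auto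
        then show False using trivial_meet aN[OF yG] y(2) one_notin_P by metis
      qed
      moreover have "\<not> i < j"
      proof
        assume "i < j"
        then have "a y \<in> sub_braid n j" using sub sub_braid_mono[of "i + 1" j n] by auto
        then have "inv\<^bsub>G\<^esub> a y \<otimes>\<^bsub>G\<^esub> a y \<in> P" using ipos_mult(2)[OF j sub_inv] ipos_P by blast
        then show False using aN[OF yG] one_notin_P by simp
      qed
      ultimately have "j = i" by simp
      with j show ?thesis by simp
    qed
    have a_one: "a y = \<one>\<^bsub>G\<^esub>" if y: "y \<in> sub_braid n i" for y
    proof (rule ccontr)
      assume "a y \<noteq> \<one>\<^bsub>G\<^esub>"
      then have "ipos_braid n i (a y)" using a_cases a_ipos y by blast
      \<comment> \<open>Conjugation by elements of \<open>sub_braid n i\<close> preserves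
        \<open>i\<close>-positivity. The conjugate \<open>?b\<close> is inverse to \<open>a\<close>
        at the inverse of \<open>y\<close>, which is itself trivial or positive, so the identity
        would be positive.\<close>
      then have pos: "inv\<^bsub>G\<^esub> y \<otimes>\<^bsub>G\<^esub> a y \<otimes>\<^bsub>G\<^esub> y \<in> P" (is "?b \<in> P")
        using ipos_mult y sub_inv ipos_P by blast
      have yG: "y \<in> carrier G" using y sub_carrier by blast
      have "?b \<otimes>\<^bsub>G\<^esub> a (inv\<^bsub>G\<^esub> y) = \<one>\<^bsub>G\<^esub>"
        unfolding a_def using yG hG by (simp add: m_assoc cancel)
      moreover have "a (inv\<^bsub>G\<^esub> y) = \<one>\<^bsub>G\<^esub> \<or> a (inv\<^bsub>G\<^esub> y) \<in> P" using a_cases sub_inv y by blast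
      ultimately show False using pos P_mult one_notin_P P_carrier by (metis r_one subsetD)
    qed
    have "h \<otimes>\<^bsub>G\<^esub> y = y \<otimes>\<^bsub>G\<^esub> h" if y: "y \<in> sub_braid n i" for y
    proof -
      have yG: "y \<in> carrier G" using y sub_carrier by blast
      then have "h = y \<otimes>\<^bsub>G\<^esub> h \<otimes>\<^bsub>G\<^esub> inv\<^bsub>G\<^esub> y"
        using eq_if[OF a_one[OF y, unfolded a_def]] hG by simp
      then show ?thesis using yG hG by (metis inv_solve_right m_closed)
    qed
    then have "h \<in> centr n (i + 1)" using h_sub by (simp add: centr_def G_def)
    moreover have "N \<inter> sub_braid n i = {\<one>\<^bsub>G\<^esub>}"
    proof -
      have "\<one>\<^bsub>G\<^esub> \<in> sub_braid n i"
        unfolding G_def one_braid_group sub_braid_def by (auto intro: exI[of _ "[]"])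
      then show ?thesis using trivial_meet N_one by blast
    qed
    \<comment> \<open>For larger \<open>r\<close> the nontrivial element \<open>h\<close> itself
      lies in the intersection.\<close>
    moreover have "r \<le> i + 1" if r: "N \<inter> sub_braid n (r - 1) = {\<one>\<^bsub>G\<^esub>}" for r
    proof (rule ccontr)
      assume "\<not> r \<le> i + 1"
      then have "i + 1 \<le> r - 1" by linarith
      then have "h \<in> sub_braid n (r - 1)" using h_sub sub_braid_mono by blast
      then have "h \<in> {\<one>\<^bsub>G\<^esub>}" unfolding r[symmetric] using h(1) by simp
      then show False using hP one_notin_P by simp
    qed
    ultimately show ?thesis using bounds False by (intro disjI2 exI[of _ "i + 1"]) auto
  qed
  ultimately show ?thesis unfolding G_def by blast
qed

end
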